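(* Let $d\ge1$, let $\chi_1,\dots,\chi_d$ be Dirichlet characters of the same modulus $q\ge 2$, let $n\in\mathbb Z$, let $k_d'$ be a non-negative integer, and let $$a_d:=-2k_d'+k_d'\frac{\log|Q|}{\log\alpha}+\left(\frac{2n}{q}+\ell_{Q,k_d'}\right)\frac{\pi i}{\log\alpha}.$$ Set $\zeta_U^{d-1}(\mathbf s\mid\mathbf r)=1$ for $d=1$. Then $$\underset{s_d=a_d}{\mathrm{Res}}\ \mathcal L_U^d(\mathbf s\mid\chi)=\sum_{r_1=1}^q\chi_1(r_1)\sum_{r_2=1}^q\chi_2(r_1+r_2)\cdots\sum_{r_d=1}^q\chi_d(r_1+\cdots+r_d)\ \zeta_U^{d-1}(s_1,\dots,s_{d-1}\mid r_1,\dots,r_{d-1})\,D^{a_d/2}\binom{-a_d}{k_d'}\frac{(-1)^{k_d'}}{q\log\alpha}\,\zeta_q^{-n(r_1+\cdots+r_d)}.$$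
   Context: Standing assumptions: $P,Q$ are real numbers with $P>0$, $Q\ne 0$, $D:=P^2-4Q$, and $Q<P-1$ if $0<P\le 2$, $Q\le P-1$ if $P>2$. Let $\alpha,\beta$ be the roots of $x^2-Px+Q=0$, with $\alpha=(P+\sqrt D)/2$, $\beta=(P-\sqrt D)/2$, and let $U_n=(\alpha^n-\beta^n)/(\alpha-\beta)$ for $n\ge 0$ (Lucas sequence of the first kind). Complex powers of positive reals are taken with the real logarithm. $\zeta_q:=e^{2\pi i/q}$. For positive integers $r_1,\dots,r_e$, the multiple shifted Lucas zeta function of depth $e$ (with modulus $q$) is the meromorphic continuation to $\mathbb C^e$ of $$\zeta_U^e(s_1,\dots,s_e\mid r_1,\dots,r_e):=\sum_{n_1,\dots,n_e=0}^\infty \frac{1}{U_{qn_1+r_1}^{s_1}}\,\frac{1}{U_{q(n_1+n_2)+(r_1+r_2)}^{s_2}}\cdots\frac{1}{U_{q(n_1+\cdots+n_e)+(r_1+\cdots+r_e)}^{s_e}}.$$ The multiple Lucas $L$-function of depth $d$ is the meromorphic continuation to $\mathbb C^d$ of $$\mathcal L_U^d(\mathbf s\mid\chi)=\mathcal L_U^d(s_1,\dots,s_d\mid\chi_1,\dots,\chi_d):=\sum_{0<n_1<\cdots<n_d}\frac{\chi_1(n_1)}{U_{n_1}^{s_1}}\cdots\frac{\chi_d(n_d)}{U_{n_d}^{s_d}}.$$ Both series (with $e=d$) converge absolutely for $(s_1,\dots,s_d)\in\mathbb C^d$ with $\sum_{i=j}^d\mathrm{Re}(s_i)>0$ for $1\le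 j\le d$. $\ell_{Q,k}:=0$ if $Q>0$ and $\ell_{Q,k}:=k$ if $Q<0$. The residue $\underset{s_d=a_d}{\mathrm{Res}}\,\mathcal L_U^d(\mathbf s\mid\chi)$ along the hyperplane $s_d=a_d$ is the restriction of the meromorphic function $(s_d-a_d)\,\mathcal L_U^d(\mathbf s\mid\chi)$ to that hyperplane. *)

theory Defs
  imports "HOL-Analysis.Analysis"
begin

section \<open>Holomorphic and meromorphic functions of several complex variables\<close>

text \<open>
  Since depths \<open>d\<close> and \<open>d - 1\<close> occur together and \<open>d - 1\<close> may be \<open>0\<close>, the space of \<open>d\<close>-tuples is not
  a type but the set of functions on \<open>{1..d}\<close>, extended by \<^const>\<open>undefined\<close>. The subspace topology
  inherited from the product topology on \<^typ>\<open>nat \<Rightarrow> complex\<close> is the usual one.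
\<close>

definition cspace :: "nat \<Rightarrow> (nat \<Rightarrow> complex) set" where
  "cspace d = ({1..d} \<rightarrow>\<^sub>E UNIV)"

text \<open>
  For \<open>V\<close> open in \<open>cspace d\<close>: continuous and holomorphic in each variable separately.
\<close>

definition mv_holomorphic :: "nat \<Rightarrow> (nat \<Rightarrow> complex) set \<Rightarrow> ((nat \<Rightarrow> complex) \<Rightarrow> complex) \<Rightarrow> bool" where
  "mv_holomorphic d V f \<longleftrightarrow>
     continuous_on V f \<and>
     (\<forall>s\<in>V. \<forall>j\<in>{1..d}. (\<lambda>z. f (s(j := z))) field_differentiable at (s j))"

text \<open>
  As for the library's one-variable meromorphic functions, the values of a total function
  representing a meromorphic function are irrelevant on a thin set. Two representatives stand for the
  same meromorphic function on \<open>V\<close> iff they agree on a dense open subset of \<open>V\<close>.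
\<close>

definition generically_equal ::
    "nat \<Rightarrow> (nat \<Rightarrow> complex) set \<Rightarrow> ((nat \<Rightarrow> complex) \<Rightarrow> complex) \<Rightarrow> ((nat \<Rightarrow> complex) \<Rightarrow> complex) \<Rightarrow> bool" where
  "generically_equal d V F G \<longleftrightarrow>
     (\<exists>W. openin (top_of_set (cspace d)) W \<and> W \<subseteq> V \<and> V \<subseteq> closure W \<and> (\<forall>s\<in>W. F s = G s))"

text \<open>
  \<open>F\<close> is the quotient \<open>g / h\<close> of holomorphic functions on the open set \<open>V\<close>. The closure condition
  says that \<open>h\<close> does not vanish identically on any nonempty open subset of \<open>V\<close>.
\<close>

definition quotient_on ::
    "nat \<Rightarrow> (nat \<Rightarrow> complex) set \<Rightarrow> ((nat \<Rightarrow> complex) \<Rightarrow> complex) \<Rightarrow>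
     ((nat \<Rightarrow> complex) \<Rightarrow> complex) \<Rightarrow> ((nat \<Rightarrow> complex) \<Rightarrow> complex) \<Rightarrow> bool" where
  "quotient_on d V F g h \<longleftrightarrow>
     openin (top_of_set (cspace d)) V \<and> mv_holomorphic d V g \<and> mv_holomorphic d V h \<and>
     V \<subseteq> closure {s \<in> V. h s \<noteq> 0} \<and> generically_equal d V F (\<lambda>s. g s / h s)"

definition mv_meromorphic :: "nat \<Rightarrow> ((nat \<Rightarrow> complex) \<Rightarrow> complex) \<Rightarrow> bool" where
  "mv_meromorphic d F \<longleftrightarrow> (\<forall>p\<in>cspace d. \<exists>V g h. p \<in> V \<and> quotient_on d V F g h)"

text \<open>
  If \<open>\<Omega>\<close> is nonempty and open in \<open>cspace d\<close>, the function chosen here is unique up to generic equality,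
  by the identity theorem.
\<close>

definition meromorphic_continuation ::
    "nat \<Rightarrow> (nat \<Rightarrow> complex) set \<Rightarrow> ((nat \<Rightarrow> complex) \<Rightarrow> complex) \<Rightarrow> (nat \<Rightarrow> complex) \<Rightarrow> complex" where
  "meromorphic_continuation d \<Omega> f = (SOME F. mv_meromorphic d F \<and> (\<forall>s\<in>\<Omega>. F s = f s))"

text \<open>
  The restriction of the meromorphic function \<open>G\<close> to the hyperplane \<open>s\<^sub>d = a\<close> is \<open>R\<close>, where the
  hyperplane is identified with \<open>cspace (d - 1)\<close> through \<open>s \<mapsto> s(d := a)\<close>. Near every point of the
  hyperplane \<open>G\<close> must be a quotient \<open>g / h\<close> whose denominator does not vanish identically on any
  nonempty open piece of the hyperplane, and \<open>R\<close> is the quotient of the restrictions of \<open>g\<close> and \<open>h\<close>.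
  This determines \<open>R\<close> up to generic equality, and does not depend on the values of the representative
  \<open>G\<close> on the hyperplane itself, where it may be meaningless.
\<close>

definition has_hyperplane_restriction ::
    "nat \<Rightarrow> complex \<Rightarrow> ((nat \<Rightarrow> complex) \<Rightarrow> complex) \<Rightarrow> ((nat \<Rightarrow> complex) \<Rightarrow> complex) \<Rightarrow> bool" where
  "has_hyperplane_restriction d a G R \<longleftrightarrow>
     (\<forall>p\<in>cspace (d - 1). \<exists>V g h. p(d := a) \<in> V \<and> quotient_on d V G g h \<and>
        quotient_on (d - 1) {s \<in> cspace (d - 1). s(d := a) \<in> V} R
          (\<lambda>s. g (s(d := a))) (\<lambda>s. h (s(d := a))))"

definition has_hyperplane_residue ::
    "nat \<Rightarrow> complex \<Rightarrow> ((nat \<Rightarrow> complex) \<Rightarrow> complex) \<Rightarrow> ((nat \<Rightarrow> complex) \<Rightarrow> complex) \<Rightarrow> bool" where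
  "has_hyperplane_residue d a F R \<longleftrightarrow> has_hyperplane_restriction d a (\<lambda>s. (s d - a) * F s) R"


section \<open>Lucas sequences and Dirichlet characters\<close>

definition lucas_params :: "real \<Rightarrow> real \<Rightarrow> bool" where
  "lucas_params P Q \<longleftrightarrow>
     P > 0 \<and> Q \<noteq> 0 \<and> (P \<le> 2 \<longrightarrow> Q < P - 1) \<and> (P > 2 \<longrightarrow> Q \<le> P - 1)"

definition lucas_D :: "real \<Rightarrow> real \<Rightarrow> real" where
  "lucas_D P Q = P\<^sup>2 - 4 * Q"

definition lucas_alpha :: "real \<Rightarrow> real \<Rightarrow> real" where
  "lucas_alpha P Q = (P + sqrt (lucas_D P Q)) / 2"

definition lucas_beta :: "real \<Rightarrow> real \<Rightarrow> real" where
  "lucas_beta P Q = (P - sqrt (lucas_D P Q)) / 2"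

definition lucas_U :: "real \<Rightarrow> real \<Rightarrow> nat \<Rightarrow> real" where
  "lucas_U P Q n =
     (lucas_alpha P Q ^ n - lucas_beta P Q ^ n) / (lucas_alpha P Q - lucas_beta P Q)"

definition lucas_ell :: "real \<Rightarrow> nat \<Rightarrow> nat" where
  "lucas_ell Q k = (if Q > 0 then 0 else k)"

definition dirichlet_character :: "nat \<Rightarrow> (int \<Rightarrow> complex) \<Rightarrow> bool" where
  "dirichlet_character q chi \<longleftrightarrow>
     (\<forall>m n. chi (m * n) = chi m * chi n) \<and>
     (\<forall>n. chi (n + int q) = chi n) \<and>
     (\<forall>n. chi n \<noteq> 0 \<longleftrightarrow> coprime n (int q))"


section \<open>Multiple shifted Lucas zeta functions and multiple Lucas L-functions\<close>

definition convergence_domain :: "nat \<Rightarrow> (nat \<Rightarrow> complex) set" where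
  "convergence_domain d = {s \<in> cspace d. \<forall>j\<in>{1..d}. (\<Sum>i=j..d. Re (s i)) > 0}"

definition lucas_zeta_series ::
    "real \<Rightarrow> real \<Rightarrow> nat \<Rightarrow> nat \<Rightarrow> (nat \<Rightarrow> nat) \<Rightarrow> (nat \<Rightarrow> complex) \<Rightarrow> complex" where
  "lucas_zeta_series P Q q e r s =
     (\<Sum>\<^sub>\<infinity>n\<in>{1..e} \<rightarrow>\<^sub>E UNIV. \<Prod>j=1..e.
        1 / complex_of_real (lucas_U P Q (q * (\<Sum>i=1..j. n i) + (\<Sum>i=1..j. r i))) powr s j)"

definition lucas_zeta ::
    "real \<Rightarrow> real \<Rightarrow> nat \<Rightarrow> nat \<Rightarrow> (nat \<Rightarrow> nat) \<Rightarrow> (nat \<Rightarrow> complex) \<Rightarrow> complex" where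
  "lucas_zeta P Q q e r =
     (if e = 0 then (\<lambda>_. 1)
      else meromorphic_continuation e (convergence_domain e) (lucas_zeta_series P Q q e r))"

definition lucas_L_series ::
    "real \<Rightarrow> real \<Rightarrow> nat \<Rightarrow> (nat \<Rightarrow> int \<Rightarrow> complex) \<Rightarrow> (nat \<Rightarrow> complex) \<Rightarrow> complex" where
  "lucas_L_series P Q d chi s =
     (\<Sum>\<^sub>\<infinity>n\<in>{n \<in> {1..d} \<rightarrow>\<^sub>E {0<..}. strict_mono_on {1..d} n}. \<Prod>j=1..d.
        chi j (int (n j)) / complex_of_real (lucas_U P Q (n j)) powr s j)"

definition lucas_L ::
    "real \<Rightarrow> real \<Rightarrow> nat \<Rightarrow> (nat \<Rightarrow> int \<Rightarrow> complex) \<Rightarrow> (nat \<Rightarrow> complex) \<Rightarrow> complex" where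
  "lucas_L P Q d chi =
     meromorphic_continuation d (convergence_domain d) (lucas_L_series P Q d chi)"

definition lucas_pole :: "real \<Rightarrow> real \<Rightarrow> nat \<Rightarrow> int \<Rightarrow> nat \<Rightarrow> complex" where
  "lucas_pole P Q q n k =
     - 2 * of_nat k + of_nat k * complex_of_real (ln \<bar>Q\<bar> / ln (lucas_alpha P Q))
     + (2 * of_int n / of_nat q + of_nat (lucas_ell Q k))
       * (complex_of_real pi * \<i> / complex_of_real (ln (lucas_alpha P Q)))"

definition zeta_root :: "nat \<Rightarrow> complex" where
  "zeta_root q = exp (2 * complex_of_real pi * \<i> / of_nat q)"

end

theory Submission
  imports Defs "HOL-Complex_Analysis.Complex_Analysis"
begin

text \<open>
  Put \<open>x = \<beta>/\<alpha>\<close>, so that \<open>0 < \<bar>x\<bar> < 1\<close>. Expanding each factor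
  \<open>U N powr (- s) = D powr (s/2) * \<alpha> powr (- s N) * (1 - x^N) powr (- s)\<close> by the binomial series and
  summing the resulting geometric series turns the shifted zeta function into a sum over
  \<open>(k 1, ..., k d)\<close> whose terms contain the factors \<open>y i ^ r i / (1 - y i ^ q)\<close>, where
  \<open>y i = \<Prod>j\<ge>i. \<alpha> powr (- s j) * x ^ k j\<close>. On a bounded polydisc only finitely many exponents of
  \<open>x\<close> can produce a pole, so multiplication by a finite product of such denominators leaves a normally
  convergent series of holomorphic functions; this is the meromorphic continuation. Writing
  \<open>n j - n (j - 1) = q * m j + r j\<close> with \<open>1 \<le> r j \<le> q\<close> expresses the \<open>L\<close>-function by shifted
  zeta functions of the same depth. At \<open>s d = a\<close> the number \<open>\<alpha> powr (- a) * x ^ k\<close> is the root of unity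
  \<open>\<zeta> powi (- n)\<close>. Since \<open>\<bar>x\<bar> \<noteq> 1\<close>, only the terms with \<open>k d = k\<close> have a pole there, and since the
  root of unity disappears from all \<open>y i ^ q\<close> they add up to the zeta function of depth \<open>d - 1\<close>.
\<close>

subsection \<open>Open dense subsets of the space of tuples\<close>

text \<open>The centre need not lie in \<open>cspace d\<close>: only its coordinates in
  \<open>{1..d}\<close> count, so the constant function 0 can serve as a centre.\<close>

definition polydisc :: "nat \<Rightarrow> (nat \<Rightarrow> complex) \<Rightarrow> real \<Rightarrow> (nat \<Rightarrow> complex) set" where
  "polydisc d p e = {s \<in> cspace d. \<forall>j\<in>{1..d}. dist (s j) (p j) < e}"

lemma openin_polydisc: "openin (top_of_set (cspace d)) (polydisc d p e)"
proof -
  have "open (\<Inter>j\<in>{1..d}. {s::nat \<Rightarrow> complex. dist (s j) (p j) < e})"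
    by (intro open_INT ballI open_Collect_less continuous_intros) auto
  moreover have "polydisc d p e = cspace d \<inter> (\<Inter>j\<in>{1..d}. {s::nat \<Rightarrow> complex. dist (s j) (p j) < e})"
    by (auto simp: polydisc_def)
  ultimately show ?thesis
    by (auto simp: openin_open)
qed

lemma polydisc_subset_cspace: "polydisc d p e \<subseteq> cspace d"
  by (auto simp: polydisc_def)

lemma centre_in_polydisc: "p \<in> cspace d \<Longrightarrow> e > 0 \<Longrightarrow> p \<in> polydisc d p e"
  by (auto simp: polydisc_def)

lemma cspace_fun_upd: "s \<in> cspace d \<Longrightarrow> j \<in> {1..d} \<Longrightarrow> s(j := z) \<in> cspace d"
  by (auto simp: cspace_def PiE_iff extensional_def)

lemma open_contains_polydisc:
  assumes "openin (top_of_set (cspace d)) V" "p \<in> V"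
  shows "\<exists>e>0. polydisc d p e \<subseteq> V"
proof -
  obtain T where T: "open T" "V = cspace d \<inter> T"
    using assms(1) by (auto simp: openin_open)
  have "openin (product_topology (\<lambda>i. euclidean) UNIV) T" "p \<in> T"
    using T assms(2) by (auto simp: open_fun_def)
  from product_topology_open_contains_basis[OF this]
  obtain X where X: "\<And>i. p i \<in> X i" "\<And>i. open (X i)" "Pi\<^sub>E UNIV X \<subseteq> T"
    by (auto simp: PiE_iff)
  have "\<exists>e>0. ball (p j) e \<subseteq> X j" for j
    using X open_contains_ball by blast
  then obtain e where e: "\<And>j. e j > 0" "\<And>j. ball (p j) (e j) \<subseteq> X j"
    by metis
  \<comment> \<open>\<open>insert 1\<close> keeps the minimum meaningful when
    \<open>d = 0\<close>.\<close>
  define \<epsilon> where "\<epsilon> = Min (insert 1 (e ` {1..d}))"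
  have pos: "\<epsilon> > 0"
    unfolding \<epsilon>_def by (subst Min_gr_iff) (auto simp: e)
  have le: "\<epsilon> \<le> e j" if "j \<in> {1..d}" for j
    unfolding \<epsilon>_def using that by (intro Min_le) auto
  have "polydisc d p \<epsilon> \<subseteq> V"
  proof
    fix s assume s: "s \<in> polydisc d p \<epsilon>"
    have "s j \<in> X j" for j
    proof (cases "j \<in> {1..d}")
      case True
      then have "dist (p j) (s j) < e j"
        using s le[of j] by (force simp: polydisc_def dist_commute)
      then show ?thesis using e(2)[of j] by auto
    next
      case False
      \<comment> \<open>Outside \<open>{1..d}\<close> both tuples take the value
        \<open>undefined\<close>, so the basic open box is respected there automatically.\<close>
      then have "s j = p j"
        using s assms(2) T(2) by (auto simp: polydisc_def cspace_def PiE_def extensional_def)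
      then show ?thesis using X by simp
    qed
    then have "s \<in> T" using X(3) by auto
    then show "s \<in> V" using s T(2) by (auto simp: polydisc_def)
  qed
  with pos show ?thesis by blast
qed

section \<open>Open dense sets and generic equality\<close>

definition open_dense_in :: "nat \<Rightarrow> (nat \<Rightarrow> complex) set \<Rightarrow> (nat \<Rightarrow> complex) set \<Rightarrow> bool" where
  "open_dense_in d V W \<longleftrightarrow> openin (top_of_set (cspace d)) W \<and> W \<subseteq> V \<and> V \<subseteq> closure W"

lemma generically_equal_iff:
  "generically_equal d V F G \<longleftrightarrow> (\<exists>W. open_dense_in d V W \<and> (\<forall>s\<in>W. F s = G s))"
  by (auto simp: generically_equal_def open_dense_in_def)

text \<open>Density tested on open subsets of \<open>V\<close>, the form in which intersections and
  restrictions are immediate. Openness of \<open>V\<close> allows every neighbourhood of a point of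
  \<open>V\<close> to be cut down to such a test set.\<close>

lemma open_dense_in_iff:
  assumes "openin (top_of_set (cspace d)) V"
  shows "open_dense_in d V W \<longleftrightarrow> openin (top_of_set (cspace d)) W \<and> W \<subseteq> V \<and>
           (\<forall>U. openin (top_of_set (cspace d)) U \<longrightarrow> U \<subseteq> V \<longrightarrow> U \<noteq> {} \<longrightarrow> U \<inter> W \<noteq> {})"
proof -
  have "V \<subseteq> closure W \<longleftrightarrow> (\<forall>U. openin (top_of_set (cspace d)) U \<longrightarrow> U \<subseteq> V \<longrightarrow> U \<noteq> {} \<longrightarrow> U \<inter> W \<noteq> {})"
    if W: "openin (top_of_set (cspace d)) W" "W \<subseteq> V"
  proof
    assume *: "V \<subseteq> closure W"
    show "\<forall>U. openin (top_of_set (cspace d)) U \<longrightarrow> U \<subseteq> V \<longrightarrow> U \<noteq> {} \<longrightarrow> U \<inter> W \<noteq> {}"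
    proof (intro allI impI)
      fix U assume U: "openin (top_of_set (cspace d)) U" "U \<subseteq> V" "U \<noteq> {}"
      then obtain T where T: "open T" "U = cspace d \<inter> T" by (auto simp: openin_open)
      have "T \<inter> closure W \<noteq> {}" using U T * by auto
      then have "T \<inter> W \<noteq> {}" using open_Int_closure_eq_empty[OF T(1)] by blast
      moreover have "W \<subseteq> cspace d" using W(1) by (auto simp: openin_open)
      ultimately show "U \<inter> W \<noteq> {}" using T by auto
    qed
  next
    assume *: "\<forall>U. openin (top_of_set (cspace d)) U \<longrightarrow> U \<subseteq> V \<longrightarrow> U \<noteq> {} \<longrightarrow> U \<inter> W \<noteq> {}"
    show "V \<subseteq> closure W"
    proof
      fix s assume s: "s \<in> V"
      show "s \<in> closure W"
        unfolding closure_iff_nhds_not_empty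
      proof (intro allI impI)
        fix A T assume T: "T \<subseteq> A" "open T" "s \<in> T"
        have "openin (top_of_set (cspace d)) (V \<inter> T)"
          using assms T(2) by (metis openin_Int_open)
        moreover have "V \<inter> T \<noteq> {}" using s T by auto
        ultimately have "(V \<inter> T) \<inter> W \<noteq> {}" using * by blast
        then show "W \<inter> A \<noteq> {}" using T by auto
      qed
    qed
  qed
  then show ?thesis by (auto simp: open_dense_in_def)
qed

text \<open>A test set meets \<open>W1\<close> in a nonempty open set, which is then a test set for
  \<open>W2\<close>.\<close>

lemma open_dense_in_Int:
  assumes "openin (top_of_set (cspace d)) V" "open_dense_in d V W1" "open_dense_in d V W2"
  shows "open_dense_in d V (W1 \<inter> W2)"
proof -
  have "U \<inter> (W1 \<inter> W2) \<noteq> {}"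
    if U: "openin (top_of_set (cspace d)) U" "U \<subseteq> V" "U \<noteq> {}" for U
  proof -
    have "openin (top_of_set (cspace d)) (U \<inter> W1)" "U \<inter> W1 \<subseteq> V" "U \<inter> W1 \<noteq> {}"
      using assms U by (auto simp: open_dense_in_iff)
    then have "(U \<inter> W1) \<inter> W2 \<noteq> {}"
      using assms(3) unfolding open_dense_in_iff[OF assms(1)] by blast
    then show ?thesis by blast
  qed
  then show ?thesis
    using assms by (auto simp: open_dense_in_iff)
qed

lemma open_dense_in_subset:
  assumes "openin (top_of_set (cspace d)) V" "openin (top_of_set (cspace d)) V'" "V' \<subseteq> V"
    and "open_dense_in d V W"
  shows "open_dense_in d V' (V' \<inter> W)"
proof -
  have "U \<inter> (V' \<inter> W) \<noteq> {}"
    if U: "openin (top_of_set (cspace d)) U" "U \<subseteq> V'" "U \<noteq> {}" for U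
  proof -
    have "U \<inter> W \<noteq> {}"
      using U assms unfolding open_dense_in_iff[OF assms(1)] by (meson order_trans)
    then show ?thesis using U by blast
  qed
  then show ?thesis
    using assms by (auto simp: open_dense_in_iff)
qed

text \<open>Glues local agreement into global agreement at the end of the identity theorem.\<close>

lemma open_dense_in_UN:
  assumes "\<And>i. i \<in> I \<Longrightarrow> open_dense_in d (V i) (W i)"
  shows "open_dense_in d (\<Union>i\<in>I. V i) (\<Union>i\<in>I. W i)"
proof -
  have "(\<Union>i\<in>I. V i) \<subseteq> closure (\<Union>i\<in>I. W i)"
  proof
    fix s assume "s \<in> (\<Union>i\<in>I. V i)"
    then obtain i where i: "i \<in> I" "s \<in> V i" by auto
    then have "s \<in> closure (W i)" using assms[OF i(1)] by (auto simp: open_dense_in_def)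
    also have "\<dots> \<subseteq> closure (\<Union>i\<in>I. W i)" using i by (intro closure_mono) auto
    finally show "s \<in> closure (\<Union>i\<in>I. W i)" .
  qed
  moreover have "openin (top_of_set (cspace d)) (\<Union>i\<in>I. W i)"
    using assms by (intro openin_Union) (auto simp: open_dense_in_def)
  moreover have "(\<Union>i\<in>I. W i) \<subseteq> (\<Union>i\<in>I. V i)"
    using assms by (auto simp: open_dense_in_def)
  ultimately show ?thesis by (simp add: open_dense_in_def)
qed

lemma open_dense_in_self: "openin (top_of_set (cspace d)) V \<Longrightarrow> open_dense_in d V V"
  by (simp add: open_dense_in_def closure_subset)

lemma generically_equal_eqI:
  "openin (top_of_set (cspace d)) V \<Longrightarrow> (\<And>s. s \<in> V \<Longrightarrow> F s = G s) \<Longrightarrow> generically_equal d V F G"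
  using open_dense_in_self by (auto simp: generically_equal_iff)

lemma generically_equal_trans:
  assumes "openin (top_of_set (cspace d)) V" "generically_equal d V F G" "generically_equal d V G H"
  shows "generically_equal d V F H"
proof -
  obtain W1 W2 where "open_dense_in d V W1" "\<forall>s\<in>W1. F s = G s"
    "open_dense_in d V W2" "\<forall>s\<in>W2. G s = H s"
    using assms(2,3) by (auto simp: generically_equal_iff)
  then show ?thesis
    using open_dense_in_Int[OF assms(1)] by (fastforce simp: generically_equal_iff)
qed

lemma generically_equal_subset:
  assumes "openin (top_of_set (cspace d)) V" "openin (top_of_set (cspace d)) V'" "V' \<subseteq> V"
    and "generically_equal d V F G"
  shows "generically_equal d V' F G"
  using open_dense_in_subset[OF assms(1-3)] assms(4) by (fastforce simp: generically_equal_iff)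

text \<open>The outer function may depend on the point, which covers multiplication by
  \<open>s d - a\<close>.\<close>

lemma generically_equal_compose:
  "generically_equal d V F G \<Longrightarrow> generically_equal d V (\<lambda>s. c s (F s)) (\<lambda>s. c s (G s))"
  by (auto simp: generically_equal_def)

lemma generically_equal_sum:
  assumes "openin (top_of_set (cspace d)) V" "finite I"
    and "\<And>i. i \<in> I \<Longrightarrow> generically_equal d V (F i) (G i)"
  shows "generically_equal d V (\<lambda>s. \<Sum>i\<in>I. F i s) (\<lambda>s. \<Sum>i\<in>I. G i s)"
  using assms(2,3)
proof (induction I rule: finite_induct)
  case empty
  then show ?case using assms(1) by (intro generically_equal_eqI) auto
next
  case (insert i I)
  obtain W1 where W1: "open_dense_in d V W1" "\<forall>s\<in>W1. F i s = G i s"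
    using insert.prems by (auto simp: generically_equal_iff)
  obtain W2 where W2: "open_dense_in d V W2" "\<forall>s\<in>W2. (\<Sum>i\<in>I. F i s) = (\<Sum>i\<in>I. G i s)"
    using insert by (auto simp: generically_equal_iff)
  have "open_dense_in d V (W1 \<inter> W2)"
    using open_dense_in_Int[OF assms(1)] W1 W2 by blast
  then show ?case
    using W1 W2 insert.hyps unfolding generically_equal_iff by (intro exI[of _ "W1 \<inter> W2"]) auto
qed


subsection \<open>Holomorphic functions of several variables\<close>

lemma mv_holomorphic_subset: "mv_holomorphic d V f \<Longrightarrow> W \<subseteq> V \<Longrightarrow> mv_holomorphic d W f"
  unfolding mv_holomorphic_def using continuous_on_subset by blast

lemma mv_holomorphic_const: "mv_holomorphic d V (\<lambda>s. c)"
  by (auto simp: mv_holomorphic_def)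

lemma mv_holomorphic_coord: "mv_holomorphic d V (\<lambda>s. s i)"
proof -
  have "continuous_on V (\<lambda>s. s i)" for V :: "(nat \<Rightarrow> complex) set"
    by (rule continuous_on_subset[OF continuous_on_product_coordinates]) auto
  moreover have "(\<lambda>z. (s(j := z)) i) field_differentiable at w" for s :: "nat \<Rightarrow> complex" and j w
    by (cases "i = j") auto
  ultimately show ?thesis by (auto simp: mv_holomorphic_def)
qed

lemma mv_holomorphic_add:
  "mv_holomorphic d V f \<Longrightarrow> mv_holomorphic d V g \<Longrightarrow> mv_holomorphic d V (\<lambda>s. f s + g s)"
  unfolding mv_holomorphic_def by (auto intro!: continuous_intros derivative_intros)

lemma mv_holomorphic_diff:
  "mv_holomorphic d V f \<Longrightarrow> mv_holomorphic d V g \<Longrightarrow> mv_holomorphic d V (\<lambda>s. f s - g s)"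
  unfolding mv_holomorphic_def by (auto intro!: continuous_intros derivative_intros)

lemma mv_holomorphic_mult:
  "mv_holomorphic d V f \<Longrightarrow> mv_holomorphic d V g \<Longrightarrow> mv_holomorphic d V (\<lambda>s. f s * g s)"
  unfolding mv_holomorphic_def by (auto intro!: continuous_intros derivative_intros)

lemma mv_holomorphic_sum:
  "(\<And>i. i \<in> I \<Longrightarrow> mv_holomorphic d V (f i)) \<Longrightarrow> mv_holomorphic d V (\<lambda>s. \<Sum>i\<in>I. f i s)"
  by (induction I rule: infinite_finite_induct) (auto intro!: mv_holomorphic_const mv_holomorphic_add)

lemma mv_holomorphic_prod:
  "(\<And>i. i \<in> I \<Longrightarrow> mv_holomorphic d V (f i)) \<Longrightarrow> mv_holomorphic d V (\<lambda>s. \<Prod>i\<in>I. f i s)"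
  by (induction I rule: infinite_finite_induct) (auto intro!: mv_holomorphic_const mv_holomorphic_mult)

lemma mv_holomorphic_compose:
  assumes "mv_holomorphic d V f" "\<phi> holomorphic_on S" "open S" "f ` V \<subseteq> S"
  shows "mv_holomorphic d V (\<lambda>s. \<phi> (f s))"
  unfolding mv_holomorphic_def
proof (intro conjI ballI)
  show "continuous_on V (\<lambda>s. \<phi> (f s))"
    by (rule continuous_on_compose2[OF holomorphic_on_imp_continuous_on[OF assms(2)]])
      (use assms in \<open>auto simp: mv_holomorphic_def\<close>)
next
  fix s j assume s: "s \<in> V" and j: "j \<in> {1..d}"
  have "\<phi> field_differentiable at (f (s(j := s j)))"
    using assms s by (auto intro!: holomorphic_on_imp_differentiable_at)
  then have "(\<phi> \<circ> (\<lambda>z. f (s(j := z)))) field_differentiable at (s j)"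
    using assms(1) s j by (intro field_differentiable_compose) (auto simp: mv_holomorphic_def)
  then show "(\<lambda>z. \<phi> (f (s(j := z)))) field_differentiable at (s j)"
    by (simp add: o_def)
qed

lemma continuous_on_fun_upd: "continuous_on V (\<lambda>s. s(d := a))" for V :: "(nat \<Rightarrow> complex) set"
proof (rule continuous_on_coordinatewise_then_product)
  fix i
  show "continuous_on V (\<lambda>s. (s(d := a)) i)"
    by (cases "i = d") (auto intro: continuous_on_subset[OF continuous_on_product_coordinates])
qed

lemma mv_holomorphic_hyperplane:
  assumes "mv_holomorphic d V f" "d \<ge> 1"
  shows "mv_holomorphic (d - 1) {s \<in> cspace (d - 1). s(d := a) \<in> V} (\<lambda>s. f (s(d := a)))"
  unfolding mv_holomorphic_def
proof (intro conjI ballI)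
  show "continuous_on {s \<in> cspace (d - 1). s(d := a) \<in> V} (\<lambda>s. f (s(d := a)))"
    by (rule continuous_on_compose2[of V f _ "\<lambda>s. s(d := a)"])
      (use assms continuous_on_fun_upd in \<open>auto simp: mv_holomorphic_def\<close>)
next
  fix s j assume s: "s \<in> {s \<in> cspace (d - 1). s(d := a) \<in> V}" and j: "j \<in> {1..d - 1}"
  then have "j \<noteq> d" "j \<in> {1..d}" using assms(2) by auto
  then have "(\<lambda>z. f ((s(d := a))(j := z))) field_differentiable at ((s(d := a)) j)"
    using s assms(1) unfolding mv_holomorphic_def by blast
  then show "(\<lambda>z. f ((s(j := z))(d := a))) field_differentiable at (s j)"
    using \<open>j \<noteq> d\<close> by (simp add: fun_upd_twist)
qed

lemma openin_nonzero:
  assumes "openin (top_of_set (cspace d)) V" "mv_holomorphic d V h"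
  shows "openin (top_of_set (cspace d)) {s \<in> V. h s \<noteq> 0}"
proof -
  have "openin (top_of_set V) (V \<inter> h -` (- {0}))"
    using assms(2) by (intro continuous_openin_preimage_gen) (auto simp: mv_holomorphic_def)
  then have "openin (top_of_set (cspace d)) (V \<inter> h -` (- {0}))"
    using assms(1) openin_trans by blast
  also have "V \<inter> h -` (- {0}) = {s \<in> V. h s \<noteq> 0}" by auto
  finally show ?thesis .
qed

text \<open>The coordinates are released from the small polydisc one at a time, so that the one-variable
  identity theorem suffices.\<close>

lemma mv_identity_polydisc:
  assumes hol: "mv_holomorphic d (polydisc d p e) f"
    and U: "openin (top_of_set (cspace d)) U" "U \<subseteq> polydisc d p e" "U \<noteq> {}"
    and zero: "\<And>s. s \<in> U \<Longrightarrow> f s = 0"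
    and s: "s \<in> polydisc d p e"
  shows "f s = 0"
proof -
  obtain w where w: "w \<in> U" using U by auto
  obtain \<eta> where \<eta>: "\<eta> > 0" "polydisc d w \<eta> \<subseteq> U"
    using open_contains_polydisc[OF U(1) w] by auto
  have wp: "dist (w j) (p j) < e" if "j \<in> {1..d}" for j
    using w U(2) that by (auto simp: polydisc_def)
  \<comment> \<open>Invariant: the coordinates up to \<open>m\<close> are free in the large
    polydisc, while those above \<open>m\<close> stay within \<eta> of \<open>w\<close>.\<close>
  have "m \<le> d \<Longrightarrow> s \<in> polydisc d p e \<Longrightarrow> (\<And>j. j \<in> {1..d} \<Longrightarrow> m < j \<Longrightarrow> dist (s j) (w j) < \<eta>) \<Longrightarrow> f s = 0"
    for m s
  proof (induction m arbitrary: s)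
    case 0
    then have "s \<in> polydisc d w \<eta>" by (auto simp: polydisc_def)
    then show ?case using \<eta>(2) zero by blast
  next
    case (Suc m)
    let ?j = "Suc m"
    let ?B = "ball (p ?j) e"
    have j: "?j \<in> {1..d}" using Suc.prems by auto
    have in_poly: "s(?j := z) \<in> polydisc d p e" if "z \<in> ?B" for z
      using that Suc.prems(2) j by (auto simp: polydisc_def cspace_fun_upd dist_commute)
    have "(\<lambda>z. f (s(?j := z))) field_differentiable at z" if "z \<in> ?B" for z
    proof -
      have "(\<lambda>u. f ((s(?j := z))(?j := u))) field_differentiable at ((s(?j := z)) ?j)"
        using hol in_poly[OF that] j unfolding mv_holomorphic_def by blast
      then show ?thesis by simp
    qed
    then have holo: "(\<lambda>z. f (s(?j := z))) holomorphic_on ?B"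
      by (auto simp: holomorphic_on_def intro: field_differentiable_at_within)
    \<comment> \<open>Only coordinate \<open>?j\<close> moves: near \<open>w ?j\<close> the
      induction hypothesis gives zero, and the one-variable identity theorem extends this to the
      whole disc.\<close>
    have "f (s(?j := s ?j)) = 0"
    proof (rule analytic_continuation_open[of "ball (w ?j) \<eta> \<inter> ?B" ?B "\<lambda>z. f (s(?j := z))" "\<lambda>_. 0"])
      show "ball (w ?j) \<eta> \<inter> ?B \<noteq> {}"
        using wp[OF j] \<eta>(1) by (metis IntI ball_eq_empty centre_in_ball dist_commute empty_iff mem_ball)
      show "s ?j \<in> ?B" using Suc.prems(2) j by (auto simp: polydisc_def dist_commute)
      fix z assume z: "z \<in> ball (w ?j) \<eta> \<inter> ?B"
      show "f (s(?j := z)) = 0"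
      proof (rule Suc.IH)
        show "m \<le> d" using Suc.prems by simp
        show "s(?j := z) \<in> polydisc d p e" using z in_poly by auto
        fix i assume "i \<in> {1..d}" "m < i"
        then show "dist ((s(?j := z)) i) (w i) < \<eta>"
          using z Suc.prems(3)[of i] by (cases "i = ?j") (auto simp: dist_commute)
      qed
    qed (use holo in auto)
    then show ?case by simp
  qed
  from this[of d] s show ?thesis by auto
qed

text \<open>For a function holomorphic on the whole space a single nonzero value suffices: if it
  vanished on some open test set, a polydisc about \<open>p\<close> reaching that set would force
  the value at \<open>p\<close> to be zero.\<close>

lemma open_dense_in_nonzero:
  assumes hol: "mv_holomorphic d (cspace d) h" and p: "p \<in> cspace d" "h p \<noteq> 0"
    and V: "openin (top_of_set (cspace d)) V"
  shows "open_dense_in d V {s \<in> V. h s \<noteq> 0}"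
  unfolding open_dense_in_iff[OF V]
proof (intro conjI allI impI)
  have sub: "V \<subseteq> cspace d" using V by (auto simp: openin_open)
  show "openin (top_of_set (cspace d)) {s \<in> V. h s \<noteq> 0}"
    using openin_nonzero[OF V mv_holomorphic_subset[OF hol sub]] .
  fix U assume U: "openin (top_of_set (cspace d)) U" "U \<subseteq> V" "U \<noteq> {}"
  show "U \<inter> {s \<in> V. h s \<noteq> 0} \<noteq> {}"
  proof
    assume *: "U \<inter> {s \<in> V. h s \<noteq> 0} = {}"
    obtain w where w: "w \<in> U" using U by auto
    \<comment> \<open>One more than the sum of the distances exceeds each of them, so the polydisc
      about \<open>p\<close> contains \<open>w\<close>.\<close>
    define e where "e = (\<Sum>j\<in>{1..d}. dist (w j) (p j)) + 1"
    have "dist (w j) (p j) < e" if "j \<in> {1..d}" for j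
      using member_le_sum[of j "{1..d}" "\<lambda>j. dist (w j) (p j)"] that by (auto simp: e_def)
    then have we: "w \<in> polydisc d p e" using w U sub by (auto simp: polydisc_def)
    have "e > 0" unfolding e_def by (intro add_nonneg_pos sum_nonneg) auto
    have "h p = 0"
    proof (rule mv_identity_polydisc[of d p e h "U \<inter> polydisc d p e"])
      show "openin (top_of_set (cspace d)) (U \<inter> polydisc d p e)"
        using U openin_polydisc by blast
      show "mv_holomorphic d (polydisc d p e) h"
        by (rule mv_holomorphic_subset[OF hol polydisc_subset_cspace])
      show "p \<in> polydisc d p e" using p \<open>e > 0\<close> by (simp add: centre_in_polydisc)
    qed (use we w U * in auto)
    then show False using p by simp
  qed
qed auto

section \<open>The identity theorem and uniqueness of meromorphic continuation\<close>

lemma connected_cspace: "connected (cspace d)"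
proof -
  have "path_connected (cspace d)"
    unfolding path_connected_def
  proof (intro ballI)
    fix p p' assume p: "p \<in> cspace d" "p' \<in> cspace d"
    define g :: "real \<Rightarrow> nat \<Rightarrow> complex"
      where "g = (\<lambda>t j. if j \<in> {1..d} then (1 - of_real t) * p j + of_real t * p' j else undefined)"
    have "continuous_on {0..1} g"
    proof (rule continuous_on_coordinatewise_then_product)
      fix j show "continuous_on {0..1} (\<lambda>t. g t j)"
        by (cases "j \<in> {1..d}") (auto simp: g_def intro!: continuous_intros)
    qed
    moreover have "g 0 = p" "g 1 = p'"
      using p by (auto simp: g_def cspace_def PiE_def extensional_def fun_eq_iff)
    moreover have "path_image g \<subseteq> cspace d"
      by (auto simp: path_image_def g_def cspace_def PiE_iff extensional_def)
    ultimately show "\<exists>g. path g \<and> path_image g \<subseteq> cspace d \<and> pathstart g = p \<and> pathfinish g = p'"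
      by (intro exI[of _ g]) (auto simp: path_def pathstart_def pathfinish_def)
  qed
  then show ?thesis by (rule path_connected_imp_connected)
qed

text \<open>The set of agreement is intersected with the nonvanishing set of the denominator, so
  that on \<open>W\<close> the division is genuine and never the default value of division by
  zero.\<close>

lemma mv_meromorphic_quotient:
  assumes "mv_meromorphic d F" "p \<in> cspace d"
  obtains V g h W where "p \<in> V" "openin (top_of_set (cspace d)) V" "mv_holomorphic d V g" "mv_holomorphic d V h"
    "open_dense_in d V W" "\<And>s. s \<in> W \<Longrightarrow> h s \<noteq> 0 \<and> F s = g s / h s"
proof -
  obtain V g h where *: "p \<in> V" "quotient_on d V F g h"
    using assms by (auto simp: mv_meromorphic_def)
  then obtain W where W: "open_dense_in d V W" "\<forall>s\<in>W. F s = g s / h s"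
    by (auto simp: quotient_on_def generically_equal_iff)
  have V: "openin (top_of_set (cspace d)) V" "mv_holomorphic d V g" "mv_holomorphic d V h"
    using * by (auto simp: quotient_on_def)
  have "open_dense_in d V {s \<in> V. h s \<noteq> 0}"
    using * openin_nonzero[OF V(1,3)] by (auto simp: open_dense_in_def quotient_on_def)
  from open_dense_in_Int[OF V(1) W(1) this] W(2) V *(1) that show thesis by blast
qed

text \<open>A clopen argument on the connected space: the union \<open>A\<close> of all open sets of
  generic agreement contains \<Omega>. Near a limit point of \<open>A\<close>, the cross difference
  of two local fractions vanishes on an open piece of a polydisc, hence on the whole
  polydisc.\<close>

lemma mv_meromorphic_identity:
  assumes F: "mv_meromorphic d F" and G: "mv_meromorphic d G"
    and \<Omega>: "openin (top_of_set (cspace d)) \<Omega>" "\<Omega> \<noteq> {}" and eq: "\<And>s. s \<in> \<Omega> \<Longrightarrow> F s = G s"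
  shows "generically_equal d (cspace d) F G"
proof -
  define A where "A = \<Union>{V. openin (top_of_set (cspace d)) V \<and> generically_equal d V F G}"
  have A_open: "openin (top_of_set (cspace d)) A"
    unfolding A_def by (intro openin_Union) auto
  have A_ne: "A \<noteq> {}"
    using \<Omega> eq generically_equal_eqI[OF \<Omega>(1), of F G] by (force simp: A_def)
  have limit_in_A: "p \<in> A" if p: "p \<in> cspace d" "p \<in> closure A" for p
  proof -
    obtain V1 g1 h1 W1 where 1: "p \<in> V1" "openin (top_of_set (cspace d)) V1" "mv_holomorphic d V1 g1"
      "mv_holomorphic d V1 h1" "open_dense_in d V1 W1" "\<And>s. s \<in> W1 \<Longrightarrow> h1 s \<noteq> 0 \<and> F s = g1 s / h1 s"
      by (rule mv_meromorphic_quotient[OF F p(1)]) blast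
    obtain V2 g2 h2 W2 where 2: "p \<in> V2" "openin (top_of_set (cspace d)) V2" "mv_holomorphic d V2 g2"
      "mv_holomorphic d V2 h2" "open_dense_in d V2 W2" "\<And>s. s \<in> W2 \<Longrightarrow> h2 s \<noteq> 0 \<and> G s = g2 s / h2 s"
      by (rule mv_meromorphic_quotient[OF G p(1)]) blast
    have "openin (top_of_set (cspace d)) (V1 \<inter> V2)" using 1 2 by blast
    then obtain e where e: "e > 0" "polydisc d p e \<subseteq> V1 \<inter> V2"
      using open_contains_polydisc[of d "V1 \<inter> V2" p] 1 2 by blast
    let ?B = "polydisc d p e"
    have B: "openin (top_of_set (cspace d)) ?B" by (rule openin_polydisc)
    have "open_dense_in d ?B ((?B \<inter> W1) \<inter> (?B \<inter> W2))"
      using 1 2 e by (intro open_dense_in_Int[OF B] open_dense_in_subset[OF _ B]) auto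
    then have W: "open_dense_in d ?B (?B \<inter> W1 \<inter> W2)" by (simp add: Int_ac)
    obtain T where T: "open T" "?B = cspace d \<inter> T" using B by (auto simp: openin_open)
    have "p \<in> T" using T e p centre_in_polydisc[of p d e] by auto
    then have "T \<inter> closure A \<noteq> {}" using p by auto
    then have "T \<inter> A \<noteq> {}" using open_Int_closure_eq_empty[OF T(1)] by blast
    then have "?B \<inter> A \<noteq> {}" using T A_open by (auto simp: openin_open)
    then obtain V where V: "openin (top_of_set (cspace d)) V" "generically_equal d V F G" "?B \<inter> V \<noteq> {}"
      by (auto simp: A_def)
    then obtain W' where W': "open_dense_in d V W'" "\<And>s. s \<in> W' \<Longrightarrow> F s = G s"
      by (auto simp: generically_equal_iff)
    have BV: "openin (top_of_set (cspace d)) (?B \<inter> V)" using V B by blast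
    have "open_dense_in d (?B \<inter> V) (((?B \<inter> V) \<inter> W') \<inter> ((?B \<inter> V) \<inter> (?B \<inter> W1 \<inter> W2)))"
      using W W' V B by (intro open_dense_in_Int[OF BV] open_dense_in_subset[OF _ BV]) auto
    \<comment> \<open>On \<open>U\<close> both fraction representations hold and \<open>F\<close>
      equals \<open>G\<close>, so the cross difference is zero there.\<close>
    then obtain U where U: "open_dense_in d (?B \<inter> V) U" "U \<subseteq> W' \<inter> W1 \<inter> W2 \<inter> ?B" by blast
    have U_ne: "U \<noteq> {}" and U_open: "openin (top_of_set (cspace d)) U"
      using U V(3) BV unfolding open_dense_in_iff[OF BV] by blast+
    have zero: "g1 s * h2 s - g2 s * h1 s = 0" if s: "s \<in> ?B" for s
    proof (rule mv_identity_polydisc[OF _ U_open _ U_ne _ s])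
      show "mv_holomorphic d ?B (\<lambda>s. g1 s * h2 s - g2 s * h1 s)"
        using 1 2 e by (intro mv_holomorphic_diff mv_holomorphic_mult) (auto elim!: mv_holomorphic_subset)
      show "U \<subseteq> ?B" using U by auto
      fix s assume "s \<in> U"
      then have "s \<in> W1" "s \<in> W2" "s \<in> W'" using U by auto
      then show "g1 s * h2 s - g2 s * h1 s = 0"
        using 1(6)[of s] 2(6)[of s] W'(2)[of s] by (auto simp: field_simps)
    qed
    have "F s = G s" if "s \<in> ?B \<inter> W1 \<inter> W2" for s
      using that zero[of s] 1(6)[of s] 2(6)[of s] by (auto simp: field_simps)
    then have "generically_equal d ?B F G" using W by (auto simp: generically_equal_iff)
    then show "p \<in> A" using B e p centre_in_polydisc[of p d e] by (auto simp: A_def)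
  qed
  have A_sub: "A \<subseteq> cspace d" using A_open by (auto simp: openin_open)
  have "A = cspace d \<inter> closure A" using limit_in_A A_sub closure_subset by blast
  then have "closedin (top_of_set (cspace d)) A" by (metis closed_closure closedin_closed)
  then have A_eq: "A = cspace d"
    using connected_cspace[of d] A_open A_ne by (auto simp: connected_clopen)
  \<comment> \<open>\<open>A\<close> being the whole space gives agreement only piece by piece; one
    dense set of agreement is chosen for each piece and their union is taken.\<close>
  define I where "I = {V. openin (top_of_set (cspace d)) V \<and> generically_equal d V F G}"
  have "\<forall>V\<in>I. \<exists>W. open_dense_in d V W \<and> (\<forall>s\<in>W. F s = G s)"
    by (auto simp: I_def generically_equal_iff)
  then obtain w where w: "\<And>V. V \<in> I \<Longrightarrow> open_dense_in d V (w V) \<and> (\<forall>s\<in>w V. F s = G s)"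
    by metis
  have "open_dense_in d (\<Union>V\<in>I. V) (\<Union>V\<in>I. w V)"
    using w by (intro open_dense_in_UN) auto
  moreover have "(\<Union>V\<in>I. V) = cspace d" using A_eq by (simp add: A_def I_def)
  ultimately show ?thesis
    unfolding generically_equal_iff using w by (intro exI[of _ "\<Union>V\<in>I. w V"]) auto
qed

text \<open>An explicit continuation \<open>F\<close> guarantees that the choice operator picks a
  continuation; the identity theorem then ties that choice to \<open>F\<close>.\<close>

lemma meromorphic_continuation_generically_equal:
  assumes "openin (top_of_set (cspace d)) \<Omega>" "\<Omega> \<noteq> {}"
    and "mv_meromorphic d F" "\<And>s. s \<in> \<Omega> \<Longrightarrow> F s = f s"
  shows "generically_equal d (cspace d) (meromorphic_continuation d \<Omega> f) F"
proof -
  have "mv_meromorphic d (meromorphic_continuation d \<Omega> f) \<and> (\<forall>s\<in>\<Omega>. meromorphic_continuation d \<Omega> f s = f s)"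
    unfolding meromorphic_continuation_def by (rule someI[of _ F]) (use assms in auto)
  then show ?thesis using assms by (intro mv_meromorphic_identity[OF _ assms(3) assms(1,2)]) auto
qed

section \<open>Normally convergent series of holomorphic functions\<close>

text \<open>The M-test makes the finite partial sums converge uniformly. Joint continuity passes to
  the limit directly, and holomorphy in each variable follows from the one-variable theorem on a
  small disc.\<close>

lemma infsum_mv_holomorphic:
  fixes t :: "'i \<Rightarrow> (nat \<Rightarrow> complex) \<Rightarrow> complex"
  assumes V: "openin (top_of_set (cspace d)) V"
    and hol: "\<And>k. k \<in> A \<Longrightarrow> mv_holomorphic d V (t k)"
    and bound: "\<And>k s. k \<in> A \<Longrightarrow> s \<in> V \<Longrightarrow> norm (t k s) \<le> b k" and b: "b summable_on A"
  shows "mv_holomorphic d V (\<lambda>s. \<Sum>\<^sub>\<infinity>k\<in>A. t k s)"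
proof -
  have lim: "uniform_limit V (\<lambda>X s. \<Sum>k\<in>X. t k s) (\<lambda>s. \<Sum>\<^sub>\<infinity>k\<in>A. t k s) (finite_subsets_at_top A)"
  proof (rule Weierstrass_m_test_general'[OF bound _ b])
    fix s assume s: "s \<in> V"
    have "(\<lambda>k. norm (t k s)) summable_on A"
      by (rule Infinite_Sum.abs_summable_on_comparison_test'[OF b]) (use bound s in auto)
    then show "((\<lambda>k. t k s) has_sum (\<Sum>\<^sub>\<infinity>k\<in>A. t k s)) A"
      by (metis has_sum_infsum Infinite_Sum.abs_summable_summable)
  qed
  have ev: "\<forall>\<^sub>F X in finite_subsets_at_top A. mv_holomorphic d V (\<lambda>s. \<Sum>k\<in>X. t k s)"
    using hol by (intro eventually_finite_subsets_at_top_weakI mv_holomorphic_sum) auto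
  show ?thesis
    unfolding mv_holomorphic_def
  proof (intro conjI ballI)
    show "continuous_on V (\<lambda>s. \<Sum>\<^sub>\<infinity>k\<in>A. t k s)"
      by (rule uniform_limit_theorem[OF _ lim])
        (use ev in \<open>auto simp: mv_holomorphic_def elim: eventually_mono\<close>)
  next
    fix s j assume s: "s \<in> V" and j: "j \<in> {1..d}"
    obtain e where e: "e > 0" "polydisc d s e \<subseteq> V" using open_contains_polydisc[OF V s] by auto
    \<comment> \<open>Half the radius keeps the closed disc inside the polydisc, whose inequalities
      are strict.\<close>
    have sub: "s(j := z) \<in> V" if "z \<in> cball (s j) (e / 2)" for z
    proof -
      have "s(j := z) \<in> polydisc d s e"
        using that e(1) s j V by (auto simp: polydisc_def openin_open cspace_fun_upd dist_commute)
      then show ?thesis using e by auto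
    qed
    have lim': "uniform_limit (cball (s j) (e / 2)) (\<lambda>X z. \<Sum>k\<in>X. t k (s(j := z)))
        (\<lambda>z. \<Sum>\<^sub>\<infinity>k\<in>A. t k (s(j := z))) (finite_subsets_at_top A)"
      using sub by (intro uniform_limit_compose'[OF lim]) auto
    have "\<forall>\<^sub>F X in finite_subsets_at_top A. 
       continuous_on (cball (s j) (e / 2)) (\<lambda>z. \<Sum>k\<in>X. t k (s(j := z))) \<and>
       (\<lambda>z. \<Sum>k\<in>X. t k (s(j := z))) holomorphic_on ball (s j) (e / 2)"
      using ev
    proof eventually_elim
      case (elim X)
      have "(\<lambda>z. \<Sum>k\<in>X. t k (s(j := z))) field_differentiable at z" if z: "z \<in> cball (s j) (e / 2)" for z
      proof -
        have "(\<lambda>u. \<Sum>k\<in>X. t k ((s(j := z))(j := u))) field_differentiable at ((s(j := z)) j)"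
          using elim sub[OF z] j unfolding mv_holomorphic_def by blast
        then show ?thesis by simp
      qed
      then have "(\<lambda>z. \<Sum>k\<in>X. t k (s(j := z))) holomorphic_on cball (s j) (e / 2)"
        by (auto simp: holomorphic_on_def intro: field_differentiable_at_within)
      then show ?case
        using ball_subset_cball holomorphic_on_imp_continuous_on holomorphic_on_subset by blast
    qed
    from holomorphic_uniform_limit[OF this lim' finite_subsets_at_top_neq_bot]
    have "(\<lambda>z. \<Sum>\<^sub>\<infinity>k\<in>A. t k (s(j := z))) holomorphic_on ball (s j) (e / 2)"
      by blast
    then show "(\<lambda>z. \<Sum>\<^sub>\<infinity>k\<in>A. t k (s(j := z))) field_differentiable at (s j)"
      using e by (auto intro!: holomorphic_on_imp_differentiable_at)
  qed
qed

subsection \<open>The binomial expansion of the Lucas zeta series\<close>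

text \<open>Polymorphic because it is applied both to the complex exponents and to the natural
  summation indices.\<close>

definition tail_sum :: "nat \<Rightarrow> (nat \<Rightarrow> 'a::comm_monoid_add) \<Rightarrow> nat \<Rightarrow> 'a" where
  "tail_sum d s i = (\<Sum>j=i..d. s j)"

text \<open>Factor by factor, \<open>-s - i\<close> has norm at most \<open>R + i\<close>, the
  absolute value of \<open>-R - i\<close>. The bound is uniform in \<open>s\<close> and is itself a
  binomial coefficient, so its power series has radius of convergence at least 1.\<close>

lemma norm_gbinomial_le:
  fixes s :: complex and R :: real
  assumes "norm s \<le> R"
  shows "norm ((- s) gchoose k) \<le> \<bar>(- R) gchoose k\<bar>"
proof -
  have "norm (\<Prod>i=0..<k. - s - of_nat i) \<le> (\<Prod>i=0..<k. \<bar>- R - of_nat i\<bar>)"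
    unfolding prod_norm[symmetric]
  proof (rule prod_mono, safe)
    fix i
    have "norm (- s - of_nat i) \<le> norm (- s) + norm (of_nat i :: complex)" by (rule norm_triangle_ineq4)
    also have "\<dots> \<le> \<bar>- R - of_nat i\<bar>" using assms norm_ge_zero[of s] by simp
    finally show "norm (- s - of_nat i) \<le> \<bar>- R - of_nat i\<bar>" .
  qed auto
  then show ?thesis
    by (simp add: gbinomial_prod_rev norm_divide abs_prod divide_right_mono)
qed

lemma summable_abs_gbinomial:
  fixes a x :: real
  assumes "\<bar>x\<bar> < 1"
  shows "(\<lambda>k. \<bar>a gchoose k\<bar> * \<bar>x\<bar> ^ k) summable_on UNIV"
proof -
  have "summable (\<lambda>k. norm ((a gchoose k) * x ^ k))"
    using assms by (intro abs_summable_in_conv_radius) (simp_all add: conv_radius_gchoose)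
  then have "summable (\<lambda>k. \<bar>a gchoose k\<bar> * \<bar>x\<bar> ^ k)"
    by (simp add: abs_mult power_abs)
  then show ?thesis
    by (intro summable_nonneg_imp_summable_on) auto
qed

lemma summable_on_prod_PiE:
  fixes f :: "'a \<Rightarrow> 'b \<Rightarrow> real"
  assumes "finite A" "\<And>x. x \<in> A \<Longrightarrow> countable (B x)" "\<And>x. x \<in> A \<Longrightarrow> f x summable_on B x"
    and "\<And>x y. x \<in> A \<Longrightarrow> y \<in> B x \<Longrightarrow> f x y \<ge> 0"
  shows "(\<lambda>g. \<Prod>x\<in>A. f x (g x)) summable_on PiE A B"
proof -
  have "(\<lambda>y. norm (f x y)) summable_on B x" if "x \<in> A" for x
    using assms(3)[OF that] assms(4)[OF that] by (subst summable_on_cong[of _ _ "f x"]) auto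
  then have "Infinite_Set_Sum.abs_summable_on (\<lambda>g. \<Prod>x\<in>A. f x (g x)) (PiE A B)"
    using assms by (intro abs_summable_on_prod_PiE) (auto simp: abs_summable_equivalent[symmetric])
  then show ?thesis
    by (metis abs_summable_equivalent Infinite_Sum.abs_summable_summable)
qed

text \<open>In the application \<open>lam\<close> is the logarithm of \<alpha>, \<open>x\<close> is
  \<beta>/\<alpha> and \<delta> is the logarithm of the discriminant; the analysis uses the Lucas
  sequence only through these numbers.\<close>

locale lucas_expansion =
  fixes lam x \<delta> :: real and q :: nat
  assumes lam: "lam > 0" and x: "x \<noteq> 0" "\<bar>x\<bar> < 1" and q: "q \<ge> 1"
begin

text \<open>The coefficient of \<open>base s k ^ N\<close> in the expansion of the N-th Lucas number
  to the power \<open>- s\<close>; the exponential is the power \<open>s/2\<close> of the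
  discriminant.\<close>

definition coef :: "nat \<Rightarrow> complex \<Rightarrow> complex" where
  "coef k s = exp (s * of_real \<delta> / 2) * ((- s) gchoose k) * (- 1) ^ k"

definition base :: "complex \<Rightarrow> nat \<Rightarrow> complex" where
  "base \<sigma> K = exp (- (of_real lam * \<sigma>)) * of_real x ^ K"

definition zeta_term :: "nat \<Rightarrow> (nat \<Rightarrow> nat) \<Rightarrow> (nat \<Rightarrow> complex) \<Rightarrow> (nat \<Rightarrow> nat) \<Rightarrow> complex" where
  "zeta_term d r s k = (\<Prod>i=1..d. coef (k i) (s i) *
     (base (tail_sum d s i) (tail_sum d k i) ^ r i / (1 - base (tail_sum d s i) (tail_sum d k i) ^ q)))"

definition zeta_cont :: "nat \<Rightarrow> (nat \<Rightarrow> nat) \<Rightarrow> (nat \<Rightarrow> complex) \<Rightarrow> complex" where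
  "zeta_cont d r s = (\<Sum>\<^sub>\<infinity>k\<in>{1..d} \<rightarrow>\<^sub>E UNIV. zeta_term d r s k)"

definition pole_factor :: "nat \<Rightarrow> complex \<Rightarrow> complex" where
  "pole_factor M \<sigma> = (\<Prod>K\<le>M. 1 - base \<sigma> K ^ q)"

text \<open>\<open>regular M \<sigma> K\<close> is \<open>pole_factor M \<sigma> / (1 - base \<sigma> K ^ q)\<close> with the removable singularities removed.\<close>

definition regular :: "nat \<Rightarrow> complex \<Rightarrow> nat \<Rightarrow> complex" where
  "regular M \<sigma> K = (\<Prod>K'\<in>{..M} - {K}. 1 - base \<sigma> K' ^ q) / (if K \<le> M then 1 else 1 - base \<sigma> K ^ q)"

definition num_term :: "nat \<Rightarrow> (nat \<Rightarrow> nat) \<Rightarrow> nat \<Rightarrow> (nat \<Rightarrow> complex) \<Rightarrow> (nat \<Rightarrow> nat) \<Rightarrow> complex" where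
  "num_term d r M s k = (\<Prod>i=1..d. coef (k i) (s i) *
     (base (tail_sum d s i) (tail_sum d k i) ^ r i * regular M (tail_sum d s i) (tail_sum d k i)))"

definition zeta_num :: "nat \<Rightarrow> (nat \<Rightarrow> nat) \<Rightarrow> nat \<Rightarrow> (nat \<Rightarrow> complex) \<Rightarrow> complex" where
  "zeta_num d r M s = (\<Sum>\<^sub>\<infinity>k\<in>{1..d} \<rightarrow>\<^sub>E UNIV. num_term d r M s k)"

definition zeta_den :: "nat \<Rightarrow> nat \<Rightarrow> (nat \<Rightarrow> complex) \<Rightarrow> complex" where
  "zeta_den d M s = (\<Prod>i=1..d. pole_factor M (tail_sum d s i))"

text \<open>For |\<sigma>| at most \<open>B\<close> the numbers \<open>base \<sigma> K\<close> with
  \<open>K > M\<close> have norm at most 1/2, so only the indices up to \<open>M\<close>, collected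
  in \<open>pole_factor M\<close>, can produce a pole.\<close>

definition admissible :: "real \<Rightarrow> nat \<Rightarrow> bool" where
  "admissible B M \<longleftrightarrow> (\<forall>K>M. exp (lam * B) * \<bar>x\<bar> ^ K \<le> 1 / 2)"

lemma norm_base: "norm (base \<sigma> K) = exp (- (lam * Re \<sigma>)) * \<bar>x\<bar> ^ K"
  by (simp add: base_def norm_mult norm_power)

lemma base_add: "base (\<sigma> + \<tau>) (K + L) = base \<sigma> K * base \<tau> L"
  by (simp add: base_def power_add exp_add[symmetric] algebra_simps)

text \<open>\<open>base\<close> is multiplicative in both arguments jointly, so tail sums of
  exponents and indices become tail products of bases.\<close>

lemma base_sum: "base (\<Sum>j\<in>I. s j) (\<Sum>j\<in>I. k j) = (\<Prod>j\<in>I. base (s j) (k j))"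
proof (induction I rule: infinite_finite_induct)
  case (insert j I)
  then show ?case by (simp add: base_add)
qed (auto simp: base_def)

lemma norm_base_le:
  assumes "norm \<sigma> \<le> B"
  shows "norm (base \<sigma> K) \<le> exp (lam * B) * \<bar>x\<bar> ^ K"
proof -
  have "- Re \<sigma> \<le> B" using assms abs_Re_le_cmod[of \<sigma>] by linarith
  then have "- (lam * Re \<sigma>) \<le> lam * B" using lam by (metis mult_le_cancel_left_pos mult_minus_right)
  then show ?thesis unfolding norm_base by (intro mult_right_mono) auto
qed

lemma norm_base_lt_1:
  assumes "Re \<sigma> > 0"
  shows "norm (base \<sigma> K) < 1"
proof -
  have "exp (- (lam * Re \<sigma>)) * \<bar>x\<bar> ^ K \<le> exp (- (lam * Re \<sigma>)) * 1"
    using x by (intro mult_left_mono power_le_one) auto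
  also have "\<dots> < 1" using assms lam by simp
  finally show ?thesis by (simp add: norm_base)
qed

lemma one_minus_base_nonzero: "norm (base \<sigma> K) < 1 \<Longrightarrow> 1 - base \<sigma> K ^ q \<noteq> 0"
proof
  assume "norm (base \<sigma> K) < 1" "1 - base \<sigma> K ^ q = 0"
  then have "norm (base \<sigma> K) ^ q = 1" by (metis norm_one norm_power right_minus_eq)
  moreover have "norm (base \<sigma> K) ^ q < 1"
    using \<open>norm (base \<sigma> K) < 1\<close> q power_less_one_iff[of "norm (base \<sigma> K)" q] by simp
  ultimately show False by simp
qed

text \<open>All large \<open>M\<close> are covered, so that \<open>M\<close> can be taken above a
  given pole index as well.\<close>

lemma admissible_exists: "\<exists>M0. \<forall>M\<ge>M0. admissible B M"
proof -
  have "(\<lambda>K. exp (lam * B) * \<bar>x\<bar> ^ K) \<longlonglongrightarrow> exp (lam * B) * 0"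
    using x by (intro tendsto_intros LIMSEQ_power_zero) auto
  then have "eventually (\<lambda>K. exp (lam * B) * \<bar>x\<bar> ^ K < 1 / 2) sequentially"
    by (rule order_tendstoD(2)) auto
  then obtain M0 where "\<And>K. K \<ge> M0 \<Longrightarrow> exp (lam * B) * \<bar>x\<bar> ^ K < 1 / 2"
    by (auto simp: eventually_sequentially)
  then show ?thesis unfolding admissible_def by (intro exI[of _ M0]) (auto intro: less_imp_le)
qed

lemma admissible_one_minus_base:
  assumes "admissible B M" "norm \<sigma> \<le> B" "K > M"
  shows "norm (1 - base \<sigma> K ^ q) \<ge> 1 / 2"
proof -
  have le: "norm (base \<sigma> K) \<le> 1 / 2"
    using norm_base_le[OF assms(2), of K] assms(1,3) by (force simp: admissible_def)
  then have "norm (base \<sigma> K) ^ q \<le> norm (base \<sigma> K) ^ 1"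
    using q by (intro power_decreasing) auto
  then have "norm (base \<sigma> K ^ q) \<le> 1 / 2" using le by (simp add: norm_power)
  then show ?thesis using norm_triangle_ineq2[of 1 "base \<sigma> K ^ q"] by simp
qed

text \<open>For \<open>K \<le> M\<close> the factor with index \<open>K\<close> cancels, being
  nonzero together with the product; for \<open>K > M\<close> nothing is removed from the
  product.\<close>

lemma regular_eq:
  assumes "pole_factor M \<sigma> \<noteq> 0"
  shows "regular M \<sigma> K = pole_factor M \<sigma> / (1 - base \<sigma> K ^ q)"
proof (cases "K \<le> M")
  case True
  have "pole_factor M \<sigma> = (1 - base \<sigma> K ^ q) * (\<Prod>K'\<in>{..M} - {K}. 1 - base \<sigma> K' ^ q)"
    unfolding pole_factor_def using True by (intro prod.remove) auto
  then show ?thesis using True assms by (auto simp: regular_def)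
qed (simp add: regular_def pole_factor_def)

text \<open>At most \<open>M + 1\<close> factors, each of norm at most \<open>E \<ge> 1\<close>,
  stand over a denominator that admissibility keeps at norm at least 1/2.\<close>

lemma regular_bound:
  assumes adm: "admissible B M"
  shows "\<exists>C\<ge>0. \<forall>\<sigma> K. norm \<sigma> \<le> B \<longrightarrow> norm (regular M \<sigma> K) \<le> C"
proof -
  define E where "E = 1 + exp (lam * B) ^ q"
  have E: "E \<ge> 1" unfolding E_def by simp
  have "norm (regular M \<sigma> K) \<le> 2 * E ^ Suc M" if s: "norm \<sigma> \<le> B" for \<sigma> K
  proof -
    have fac: "norm (1 - base \<sigma> K' ^ q) \<le> E" for K'
    proof -
      have "norm (base \<sigma> K') \<le> exp (lam * B) * \<bar>x\<bar> ^ K'" by (rule norm_base_le[OF s])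
      also have "\<dots> \<le> exp (lam * B) * 1" using x by (intro mult_left_mono power_le_one) auto
      finally have "norm (base \<sigma> K' ^ q) \<le> exp (lam * B) ^ q"
        unfolding norm_power by (intro power_mono) auto
      then show ?thesis using norm_triangle_ineq4[of 1 "base \<sigma> K' ^ q"] by (simp add: E_def)
    qed
    have "norm (\<Prod>K'\<in>{..M} - {K}. 1 - base \<sigma> K' ^ q) \<le> (\<Prod>K'\<in>{..M} - {K}. E)"
      unfolding prod_norm[symmetric] using fac by (intro prod_mono) auto
    also have "\<dots> \<le> E ^ Suc M"
      unfolding prod_constant using E card_mono[of "{..M}" "{..M} - {K}"]
      by (intro power_increasing) auto
    finally have num: "norm (\<Prod>K'\<in>{..M} - {K}. 1 - base \<sigma> K' ^ q) \<le> E ^ Suc M" .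
    have den: "norm (if K \<le> M then 1 else 1 - base \<sigma> K ^ q) \<ge> 1 / 2"
      using admissible_one_minus_base[OF adm s, of K] by auto
    have "norm (regular M \<sigma> K) \<le> E ^ Suc M / (1 / 2)"
      unfolding regular_def norm_divide using num den E by (intro frac_le) auto
    then show ?thesis by simp
  qed
  moreover have "2 * E ^ Suc M \<ge> 0" using E by simp
  ultimately show ?thesis by blast
qed

lemma norm_coef_le:
  assumes "norm s \<le> R"
  shows "norm (coef k s) \<le> exp (R * \<bar>\<delta>\<bar>) * \<bar>(- R) gchoose k\<bar>"
proof -
  have "R \<ge> 0" using assms norm_ge_zero order_trans by blast
  have "Re s * \<delta> / 2 \<le> \<bar>Re s\<bar> * \<bar>\<delta>\<bar> / 2" by (metis abs_ge_self abs_mult divide_right_mono zero_le_numeral)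
  also have "\<dots> \<le> R * \<bar>\<delta>\<bar> / 2"
    using assms abs_Re_le_cmod[of s] by (intro divide_right_mono mult_right_mono) auto
  also have "\<dots> \<le> R * \<bar>\<delta>\<bar>" using \<open>R \<ge> 0\<close> by simp
  finally have "norm (exp (s * of_real \<delta> / 2)) \<le> exp (R * \<bar>\<delta>\<bar>)" by simp
  then show ?thesis
    unfolding coef_def norm_mult using norm_gbinomial_le[OF assms, of k]
    by (auto intro!: mult_mono simp: norm_power)
qed

lemma norm_tail_sum_le:
  fixes s :: "nat \<Rightarrow> complex"
  assumes "\<And>j. j \<in> {1..d} \<Longrightarrow> norm (s j) \<le> R" "i \<in> {1..d}"
  shows "norm (tail_sum d s i) \<le> of_nat d * R"
proof -
  have "norm (tail_sum d s i) \<le> (\<Sum>j=i..d. R)"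
    unfolding tail_sum_def using assms by (intro sum_norm_le) auto
  also have "\<dots> = of_nat (card {i..d}) * R" by simp
  also have "\<dots> \<le> of_nat d * R"
    using assms order_trans[OF norm_ge_zero assms(1)[OF assms(2)]] by (intro mult_right_mono) auto
  finally show ?thesis .
qed

text \<open>The majorant must be a product over the coordinates although the bases involve tail sums
  of \<open>k\<close>; bounding each tail sum below by its first entry decouples them.\<close>

lemma num_term_bound:
  assumes adm: "admissible (of_nat d * R) M" and r: "\<And>i. i \<in> {1..d} \<Longrightarrow> r i \<ge> 1"
  shows "\<exists>b. b summable_on ({1..d} \<rightarrow>\<^sub>E UNIV) \<and>
     (\<forall>k s. (\<forall>j\<in>{1..d}. norm (s j) \<le> R) \<longrightarrow> norm (num_term d r M s k) \<le> b k)"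
proof -
  define B where "B = of_nat d * R"
  obtain C where C: "C \<ge> 0" "\<And>\<sigma> K. norm \<sigma> \<le> B \<Longrightarrow> norm (regular M \<sigma> K) \<le> C"
    using regular_bound[OF adm] by (auto simp: B_def)
  define b where "b = (\<lambda>i l. exp (R * \<bar>\<delta>\<bar>) * exp (lam * B) ^ r i * C * (\<bar>(- R) gchoose l\<bar> * \<bar>x\<bar> ^ l))"
  have "(\<lambda>k. \<Prod>i=1..d. b i (k i)) summable_on ({1..d} \<rightarrow>\<^sub>E UNIV)"
  proof (rule summable_on_prod_PiE)
    show "b i summable_on UNIV" for i
      unfolding b_def by (intro summable_on_cmult_right summable_abs_gbinomial x)
  qed (use C in \<open>auto simp: b_def\<close>)
  moreover have "norm (num_term d r M s k) \<le> (\<Prod>i=1..d. b i (k i))"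
    if s: "\<And>j. j \<in> {1..d} \<Longrightarrow> norm (s j) \<le> R" for s k
    unfolding num_term_def prod_norm[symmetric]
  proof (rule prod_mono, intro conjI norm_ge_zero)
    fix i assume i: "i \<in> {1..d}"
    let ?\<sigma> = "tail_sum d s i" and ?K = "tail_sum d k i"
    have \<sigma>: "norm ?\<sigma> \<le> B" unfolding B_def using s i by (intro norm_tail_sum_le) auto
    \<comment> \<open>Since \<open>r i \<ge> 1\<close>, the power \<open>r i\<close> of the base
      still supplies the decay \<open>\<bar>x\<bar> ^ k i\<close> that makes the binomial series
      summable.\<close>
    have "k i \<le> ?K" unfolding tail_sum_def using i by (intro member_le_sum) auto
    also have "\<dots> \<le> ?K * r i" using r[OF i] by simp
    finally have K: "k i \<le> ?K * r i" .
    have "norm (base ?\<sigma> ?K ^ r i) \<le> (exp (lam * B) * \<bar>x\<bar> ^ ?K) ^ r i"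
      unfolding norm_power by (intro power_mono norm_base_le \<sigma>) auto
    also have "\<dots> = exp (lam * B) ^ r i * \<bar>x\<bar> ^ (?K * r i)"
      by (simp add: power_mult_distrib power_mult)
    also have "\<dots> \<le> exp (lam * B) ^ r i * \<bar>x\<bar> ^ k i"
      using x K by (intro mult_left_mono power_decreasing) auto
    finally have 1: "norm (base ?\<sigma> ?K ^ r i) \<le> exp (lam * B) ^ r i * \<bar>x\<bar> ^ k i" .
    have "norm (coef (k i) (s i) * (base ?\<sigma> ?K ^ r i * regular M ?\<sigma> ?K))
        \<le> (exp (R * \<bar>\<delta>\<bar>) * \<bar>(- R) gchoose (k i)\<bar>) * ((exp (lam * B) ^ r i * \<bar>x\<bar> ^ k i) * C)"
      unfolding norm_mult by (intro mult_mono norm_coef_le s i 1 C \<sigma> mult_nonneg_nonneg) auto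
    then show "norm (coef (k i) (s i) * (base ?\<sigma> ?K ^ r i * regular M ?\<sigma> ?K)) \<le> b i (k i)"
      by (simp add: b_def mult_ac)
  qed
  ultimately show ?thesis by (intro exI[of _ "\<lambda>k. \<Prod>i=1..d. b i (k i)"]) blast
qed

section \<open>Local numerators and denominators of the continuation\<close>

lemma holomorphic_base: "(\<lambda>\<sigma>. base \<sigma> K) holomorphic_on S"
  unfolding base_def by (intro holomorphic_intros)

lemma holomorphic_coef: "coef k holomorphic_on S"
  unfolding coef_def gbinomial_prod_rev by (intro holomorphic_intros) auto

lemma holomorphic_pole_factor: "pole_factor M holomorphic_on S"
  unfolding pole_factor_def
  by (intro holomorphic_on_prod holomorphic_on_diff holomorphic_on_const holomorphic_on_power holomorphic_base)

lemma holomorphic_regular: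
  assumes "admissible B M"
  shows "(\<lambda>\<sigma>. regular M \<sigma> K) holomorphic_on ball 0 B"
  unfolding regular_def
proof (intro holomorphic_on_divide holomorphic_on_prod)
  show "(\<lambda>\<sigma>. if K \<le> M then 1 else 1 - base \<sigma> K ^ q) holomorphic_on ball 0 B"
    by (cases "K \<le> M") (auto intro!: holomorphic_on_diff holomorphic_on_const holomorphic_on_power holomorphic_base)
  fix \<sigma> :: complex assume "\<sigma> \<in> ball 0 B"
  then have "1 / 2 \<le> norm (if K \<le> M then 1 else 1 - base \<sigma> K ^ q)"
    using admissible_one_minus_base[OF assms, of \<sigma> K] by auto
  then show "(if K \<le> M then 1 else 1 - base \<sigma> K ^ q) \<noteq> 0"
    by (metis norm_zero not_less zero_less_divide_1_iff zero_less_numeral)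
qed (intro holomorphic_on_diff holomorphic_on_const holomorphic_on_power holomorphic_base)

lemma mv_holomorphic_tail_sum: "mv_holomorphic d V (\<lambda>s. tail_sum e s i)"
  unfolding tail_sum_def by (intro mv_holomorphic_sum mv_holomorphic_coord)

lemma mv_holomorphic_zeta_den: "mv_holomorphic d V (zeta_den d M)"
  unfolding zeta_den_def
  by (intro mv_holomorphic_prod mv_holomorphic_compose[OF mv_holomorphic_tail_sum holomorphic_pole_factor[of _ UNIV]])
    auto

lemma polydisc_0: "s \<in> polydisc d (\<lambda>_. 0) R \<longleftrightarrow> s \<in> cspace d \<and> (\<forall>j\<in>{1..d}. norm (s j) < R)"
  by (auto simp: polydisc_def)

lemma mv_holomorphic_zeta_num:
  assumes adm: "admissible (of_nat d * R) M" and r: "\<And>i. i \<in> {1..d} \<Longrightarrow> r i \<ge> 1"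
  shows "mv_holomorphic d (polydisc d (\<lambda>_. 0) R) (zeta_num d r M)"
proof -
  obtain b where b_all: "b summable_on ({1..d} \<rightarrow>\<^sub>E UNIV) \<and>
    (\<forall>k s. (\<forall>j\<in>{1..d}. norm (s j) \<le> R) \<longrightarrow> norm (num_term d r M s k) \<le> b k)"
    using num_term_bound[of d R M r, OF adm r] by (rule exE)
  then have b: "b summable_on ({1..d} \<rightarrow>\<^sub>E UNIV)"
    "\<And>k s. (\<forall>j\<in>{1..d}. norm (s j) \<le> R) \<Longrightarrow> norm (num_term d r M s k) \<le> b k"
    by simp_all
  \<comment> \<open>\<open>regular\<close> is holomorphic on an open ball, so a strict bound is
    needed; the maximum of the finitely many norms lies strictly below \<open>R\<close>.\<close>
  have tail: "norm (tail_sum d s i) < of_nat d * R"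
    if s: "s \<in> polydisc d (\<lambda>_. 0) R" and i: "i \<in> {1..d}" for s i
  proof -
    have lt: "norm (s j) < R" if "j \<in> {1..d}" for j using s that by (auto simp: polydisc_0)
    define R' where "R' = Max ((\<lambda>j. norm (s j)) ` {1..d})"
    have "R' < R" unfolding R'_def using i lt by (subst Max_less_iff) auto
    moreover have "norm (tail_sum d s i) \<le> of_nat d * R'"
      unfolding R'_def using i by (intro norm_tail_sum_le) auto
    ultimately show ?thesis using i by (smt (verit) atLeastAtMost_iff mult_strict_left_mono of_nat_0_less_iff order.strict_trans2 zero_less_one_class.zero_less_one less_eq_Suc_le One_nat_def)
  qed
  show ?thesis
    unfolding zeta_num_def
  proof (rule infsum_mv_holomorphic[OF openin_polydisc _ _ b(1)])
    fix k :: "nat \<Rightarrow> nat"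
    show "mv_holomorphic d (polydisc d (\<lambda>_. 0) R) (\<lambda>s. num_term d r M s k)"
      unfolding num_term_def
    proof (intro mv_holomorphic_prod mv_holomorphic_mult)
      fix i assume i: "i \<in> {1..d}"
      show "mv_holomorphic d (polydisc d (\<lambda>_. 0) R) (\<lambda>s. coef (k i) (s i))"
        by (rule mv_holomorphic_compose[OF mv_holomorphic_coord holomorphic_coef[of _ UNIV]]) auto
      have "mv_holomorphic d (polydisc d (\<lambda>_. 0) R) (\<lambda>s. base (tail_sum d s i) (tail_sum d k i))"
        by (rule mv_holomorphic_compose[OF mv_holomorphic_tail_sum holomorphic_base[of _ UNIV]]) auto
      from mv_holomorphic_compose[OF this, of "\<lambda>z. z ^ r i" UNIV]
      show "mv_holomorphic d (polydisc d (\<lambda>_. 0) R) (\<lambda>s. base (tail_sum d s i) (tail_sum d k i) ^ r i)"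
        by (simp add: holomorphic_on_power)
      show "mv_holomorphic d (polydisc d (\<lambda>_. 0) R) (\<lambda>s. regular M (tail_sum d s i) (tail_sum d k i))"
        by (rule mv_holomorphic_compose[OF mv_holomorphic_tail_sum holomorphic_regular[OF adm]])
          (use tail i in auto)
    qed
  next
    fix k s assume "s \<in> polydisc d (\<lambda>_. 0) R"
    then show "norm (num_term d r M s k) \<le> b k"
      by (intro b(2)) (auto simp: polydisc_0 less_imp_le)
  qed
qed

text \<open>The denominator does not depend on \<open>k\<close> and can be taken into the infinite
  sum, where its \<open>i\<close>-th pole factor turns the \<open>i\<close>-th geometric denominator
  into \<open>regular\<close>.\<close>

lemma zeta_num_eq:
  assumes "zeta_den d M s \<noteq> 0"
  shows "zeta_cont d r s = zeta_num d r M s / zeta_den d M s"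
proof -
  have "num_term d r M s k = zeta_term d r s k * zeta_den d M s" for k
  proof -
    have "pole_factor M (tail_sum d s i) \<noteq> 0" if "i \<in> {1..d}" for i
      using assms that by (auto simp: zeta_den_def)
    then show ?thesis
      unfolding num_term_def zeta_term_def zeta_den_def prod.distrib[symmetric]
      by (intro prod.cong) (auto simp: regular_eq)
  qed
  then have "zeta_num d r M s = zeta_cont d r s * zeta_den d M s"
    unfolding zeta_num_def zeta_cont_def by (subst infsum_cmult_left'[symmetric]) (rule infsum_cong)
  then show ?thesis using assms by simp
qed

lemma Re_tail_sum_pos:
  assumes "s \<in> convergence_domain d" "i \<in> {1..d}"
  shows "Re (tail_sum d s i) > 0"
  using assms by (auto simp: convergence_domain_def tail_sum_def)

lemma zeta_den_nonzero:
  assumes "s \<in> convergence_domain d"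
  shows "zeta_den d M s \<noteq> 0"
  unfolding zeta_den_def pole_factor_def
  using Re_tail_sum_pos[OF assms] norm_base_lt_1 one_minus_base_nonzero by auto

lemma convergence_domain_nonempty: "(\<lambda>j. if j \<in> {1..d} then 1 else undefined) \<in> convergence_domain d"
  by (auto simp: convergence_domain_def cspace_def PiE_iff extensional_def)

lemma openin_convergence_domain: "openin (top_of_set (cspace d)) (convergence_domain d)"
proof -
  have "open (\<Inter>j\<in>{1..d}. {s::nat \<Rightarrow> complex. (\<Sum>i=j..d. Re (s i)) > 0})"
    by (intro open_INT ballI open_Collect_less continuous_intros) auto
  moreover have "convergence_domain d = cspace d \<inter> (\<Inter>j\<in>{1..d}. {s::nat \<Rightarrow> complex. (\<Sum>i=j..d. Re (s i)) > 0})"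
    by (auto simp: convergence_domain_def)
  ultimately show ?thesis
    by (auto simp: openin_open)
qed

lemma open_dense_in_zeta_den:
  assumes "openin (top_of_set (cspace d)) V"
  shows "open_dense_in d V {s \<in> V. zeta_den d M s \<noteq> 0}"
  by (rule open_dense_in_nonzero[OF mv_holomorphic_zeta_den _ zeta_den_nonzero[OF convergence_domain_nonempty] assms])
    (use convergence_domain_nonempty in \<open>auto simp: convergence_domain_def\<close>)

text \<open>The denominator \<open>zeta_den\<close> is independent of \<open>r\<close>, so a linear
  combination has it as a common local denominator.\<close>

lemma mv_meromorphic_zeta_cont:
  assumes r: "\<And>r i. r \<in> I \<Longrightarrow> i \<in> {1..d} \<Longrightarrow> r i \<ge> 1"
  shows "mv_meromorphic d (\<lambda>s. \<Sum>r\<in>I. c r * zeta_cont d r s)"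
  unfolding mv_meromorphic_def
proof
  fix p assume p: "p \<in> cspace d"
  \<comment> \<open>A polydisc about the origin large enough to contain \<open>p\<close>; the bounds
    above are formulated on such polydiscs.\<close>
  define R where "R = (\<Sum>j\<in>{1..d}. norm (p j)) + 1"
  have "norm (p j) < R" if "j \<in> {1..d}" for j
    using member_le_sum[of j "{1..d}" "\<lambda>j. norm (p j)"] that by (auto simp: R_def)
  then have pR: "p \<in> polydisc d (\<lambda>_. 0) R" using p by (auto simp: polydisc_0)
  obtain M where M: "admissible (of_nat d * R) M" using admissible_exists by blast
  let ?V = "polydisc d (\<lambda>_. 0) R"
  have dense: "open_dense_in d ?V {s \<in> ?V. zeta_den d M s \<noteq> 0}"
    by (rule open_dense_in_zeta_den[OF openin_polydisc])
  have "quotient_on d ?V (\<lambda>s. \<Sum>r\<in>I. c r * zeta_cont d r s)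
      (\<lambda>s. \<Sum>r\<in>I. c r * zeta_num d r M s) (zeta_den d M)"
    unfolding quotient_on_def
  proof (intro conjI)
    show "generically_equal d ?V (\<lambda>s. \<Sum>r\<in>I. c r * zeta_cont d r s)
        (\<lambda>s. (\<Sum>r\<in>I. c r * zeta_num d r M s) / zeta_den d M s)"
      unfolding generically_equal_iff using dense
      by (auto simp: zeta_num_eq sum_divide_distrib intro!: exI[of _ "{s \<in> ?V. zeta_den d M s \<noteq> 0}"] sum.cong)
  qed (use dense M r in \<open>auto simp: open_dense_in_def openin_polydisc mv_holomorphic_zeta_den
        intro!: mv_holomorphic_sum mv_holomorphic_mult mv_holomorphic_const mv_holomorphic_zeta_num\<close>)
  then show "\<exists>V g h. p \<in> V \<and> quotient_on d V (\<lambda>s. \<Sum>r\<in>I. c r * zeta_cont d r s) g h"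
    using pR by blast
qed

end

subsection \<open>The series on the domain of convergence\<close>

lemma gbinomial_powser_has_sum:
  fixes s z :: complex
  assumes "norm z < 1"
  shows "((\<lambda>k. (s gchoose k) * z ^ k) has_sum (1 + z) powr s) UNIV"
proof (rule norm_summable_imp_has_sum)
  show "summable (\<lambda>k. norm ((s gchoose k) * z ^ k))"
    using assms by (intro abs_summable_in_conv_radius) (simp_all add: conv_radius_gchoose)
qed (rule gen_binomial_complex[OF assms])

text \<open>Exchanging the two products turns partial sums of exponents into tail products of bases;
  this is how tail sums enter the expansion.\<close>

lemma prod_tail_power:
  fixes b :: "nat \<Rightarrow> 'a::comm_semiring_1"
  shows "(\<Prod>j=1..d. b j ^ (\<Sum>i=1..j. e i)) = (\<Prod>i=1..d. (\<Prod>j=i..d. b j) ^ e i)"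
proof -
  have "(\<Prod>j=1..d. b j ^ (\<Sum>i=1..j. e i)) = (\<Prod>j=1..d. \<Prod>i | i \<in> {1..d} \<and> i \<le> j. b j ^ e i)"
    unfolding power_sum by (intro prod.cong) auto
  also have "\<dots> = (\<Prod>i=1..d. \<Prod>j | j \<in> {1..d} \<and> i \<le> j. b j ^ e i)"
    by (rule prod.swap_restrict) auto
  also have "\<dots> = (\<Prod>i=1..d. (\<Prod>j=i..d. b j) ^ e i)"
  proof (rule prod.cong[OF refl])
    fix i assume "i \<in> {1..d}"
    then have "{j. j \<in> {1..d} \<and> i \<le> j} = {i..d}" by auto
    then show "(\<Prod>j | j \<in> {1..d} \<and> i \<le> j. b j ^ e i) = (\<Prod>j=i..d. b j) ^ e i"
      by (simp only: prod_power_distrib[symmetric])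
  qed
  finally show ?thesis .
qed

lemma summable_on_product:
  fixes f :: "'a \<Rightarrow> real" and g :: "'b \<Rightarrow> real"
  assumes "f summable_on A" "g summable_on B" "\<And>x. x \<in> A \<Longrightarrow> f x \<ge> 0" "\<And>y. y \<in> B \<Longrightarrow> g y \<ge> 0"
  shows "(\<lambda>(x, y). f x * g y) summable_on A \<times> B"
proof (rule summable_on_SigmaI)
  fix x
  show "((\<lambda>y. case (x, y) of (x, y) \<Rightarrow> f x * g y) has_sum f x * infsum g B) B"
    using assms by (auto intro!: has_sum_cmult_right has_sum_infsum)
qed (use assms in \<open>auto intro!: summable_on_cmult_left\<close>)

lemma geometric_has_sum:
  fixes b :: complex
  assumes "norm b < 1" "q \<ge> 1"
  shows "((\<lambda>m. b ^ (q * m + r)) has_sum (b ^ r / (1 - b ^ q))) UNIV"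
proof -
  have "norm (b ^ q) < 1"
    using assms power_less_one_iff[of "norm b" q] by (simp add: norm_power)
  moreover have "summable (\<lambda>m. norm ((b ^ q) ^ m))"
    using calculation unfolding norm_power[of "b ^ q"] by (intro summable_geometric) simp
  ultimately have "((\<lambda>m. (b ^ q) ^ m) has_sum (1 / (1 - b ^ q))) UNIV"
    using norm_summable_imp_has_sum geometric_sums by blast
  then have "((\<lambda>m. b ^ r * (b ^ q) ^ m) has_sum (b ^ r * (1 / (1 - b ^ q)))) UNIV"
    by (rule has_sum_cmult_right)
  also have "(\<lambda>m. b ^ r * (b ^ q) ^ m) = (\<lambda>m. b ^ (q * m + r))"
    by (simp add: power_add power_mult mult.commute[of "b ^ r"])
  finally show ?thesis by simp
qed

context lucas_expansion
begin

definition seqU :: "nat \<Rightarrow> real" where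
  "seqU N = exp (lam * N - \<delta> / 2) * (1 - x ^ N)"

text \<open>The binomial series with exponent \<open>- s\<close> at the point
  \<open>- x ^ N\<close>, multiplied by the part of the power that does not depend on
  \<open>k\<close>.\<close>

lemma seqU_powr_expansion:
  assumes N: "N \<ge> 1"
  shows "((\<lambda>k. coef k s * base s k ^ N) has_sum 1 / of_real (seqU N) powr s) UNIV"
proof -
  have xN: "norm (- (of_real x ^ N) :: complex) < 1"
    using x N power_less_one_iff[of "\<bar>x\<bar>" N] by (simp add: norm_power)
  define c where "c = exp (s * of_real \<delta> / 2) * exp (- (of_real lam * s)) ^ N"
  have "((\<lambda>k. c * (((- s) gchoose k) * (- (of_real x ^ N)) ^ k)) has_sum
      c * (1 + - (of_real x ^ N)) powr (- s)) UNIV"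
    by (intro has_sum_cmult_right gbinomial_powser_has_sum xN)
  also have "(\<lambda>k. c * (((- s) gchoose k) * (- (of_real x ^ N)) ^ k)) = (\<lambda>k. coef k s * base s k ^ N)"
  proof
    fix k
    have "(- (of_real x ^ N)) ^ k = (-1) ^ k * (of_real x ^ k :: complex) ^ N"
      by (subst power_minus) (simp add: power_mult[symmetric] mult.commute)
    then show "c * (((- s) gchoose k) * (- (of_real x ^ N)) ^ k) = coef k s * base s k ^ N"
      by (simp add: c_def coef_def base_def power_mult_distrib mult_ac)
  qed
  also have "c * (1 + - (of_real x ^ N)) powr (- s) = 1 / of_real (seqU N) powr s"
  proof -
    have "x ^ N \<le> \<bar>x\<bar> ^ N" by (metis abs_ge_self power_abs)
    also have "\<dots> < 1" using x N power_less_one_iff[of "\<bar>x\<bar>" N] by auto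
    finally have pos: "1 - x ^ N > 0" by simp
    \<comment> \<open>Both factors of \<open>seqU N\<close> are positive reals, so the complex power
      splits without a change of branch.\<close>
    have "of_real (seqU N) powr s = of_real (exp (lam * N - \<delta> / 2)) powr s * of_real (1 - x ^ N) powr s"
      unfolding seqU_def of_real_mult using pos by (intro powr_times_real) (auto simp: complex_is_Real_iff)
    also have "of_real (exp (lam * N - \<delta> / 2)) powr s = exp (s * of_real (lam * N - \<delta> / 2))"
      by (simp add: powr_def Ln_of_real)
    also have "\<dots> = inverse c"
      unfolding c_def by (simp add: exp_of_nat_mult[symmetric] exp_minus[symmetric] exp_add[symmetric] algebra_simps)
    finally show ?thesis by (simp add: powr_minus field_simps)
  qed
  finally show ?thesis .
qed

lemma summable_coef: "(\<lambda>k. norm (coef k s) * \<bar>x\<bar> ^ k) summable_on UNIV"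
proof (rule summable_on_comparison_test)
  show "(\<lambda>k. exp (norm s * \<bar>\<delta>\<bar>) * (\<bar>(- norm s) gchoose k\<bar> * \<bar>x\<bar> ^ k)) summable_on UNIV"
    by (intro summable_on_cmult_right summable_abs_gbinomial x)
  show "norm (coef k s) * \<bar>x\<bar> ^ k \<le> exp (norm s * \<bar>\<delta>\<bar>) * (\<bar>(- norm s) gchoose k\<bar> * \<bar>x\<bar> ^ k)" for k
    using mult_right_mono[OF norm_coef_le[of s "norm s" k], of "\<bar>x\<bar> ^ k"] by (simp add: mult_ac)
qed auto

section \<open>The double series over lattice indices and binomial indices\<close>

definition index_sum :: "(nat \<Rightarrow> nat) \<Rightarrow> (nat \<Rightarrow> nat) \<Rightarrow> nat \<Rightarrow> nat" where
  "index_sum r m j = q * (\<Sum>i=1..j. m i) + (\<Sum>i=1..j. r i)"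

definition double_term :: "nat \<Rightarrow> (nat \<Rightarrow> nat) \<Rightarrow> (nat \<Rightarrow> complex) \<Rightarrow> (nat \<Rightarrow> nat) \<Rightarrow> (nat \<Rightarrow> nat) \<Rightarrow> complex" where
  "double_term d r s m k = (\<Prod>j=1..d. coef (k j) (s j) * base (s j) (k j) ^ index_sum r m j)"

lemma index_sum_eq: "index_sum r m j = (\<Sum>i=1..j. q * m i + r i)"
  by (simp add: index_sum_def sum.distrib sum_distrib_left)

lemma index_sum_pos:
  assumes "\<And>i. i \<in> {1..d} \<Longrightarrow> r i \<ge> 1" "j \<in> {1..d}"
  shows "index_sum r m j \<ge> 1"
proof -
  have "1 \<le> r j" using assms by auto
  also have "r j \<le> (\<Sum>i=1..j. r i)" using assms(2) by (intro member_le_sum) auto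
  finally show ?thesis by (simp add: index_sum_def)
qed

text \<open>The definition separates the variables \<open>k j\<close> for fixed \<open>m\<close>;
  this form separates the variables \<open>m i\<close> for fixed \<open>k\<close>. Each is used for
  one order of summation.\<close>

lemma double_term_eq:
  "double_term d r s m k = (\<Prod>j=1..d. coef (k j) (s j)) *
     (\<Prod>i=1..d. base (tail_sum d s i) (tail_sum d k i) ^ (q * m i + r i))"
  unfolding double_term_def index_sum_eq prod.distrib prod_tail_power
  by (simp add: tail_sum_def base_sum)

text \<open>A product majorant: \<open>G\<close> is a product of geometric terms, convergent because
  the tail sums have positive real part, and \<open>H\<close> is a product of binomial
  terms.\<close>

lemma double_term_summable:
  assumes s: "s \<in> convergence_domain d" and r: "\<And>i. i \<in> {1..d} \<Longrightarrow> r i \<ge> 1"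
  shows "(\<lambda>(m, k). double_term d r s m k) summable_on ({1..d} \<rightarrow>\<^sub>E UNIV) \<times> ({1..d} \<rightarrow>\<^sub>E UNIV)"
proof -
  define G where "G = (\<lambda>m::nat \<Rightarrow> nat. \<Prod>i=1..d. norm (base (tail_sum d s i) 0) ^ (q * m i + r i))"
  define H where "H = (\<lambda>k::nat \<Rightarrow> nat. \<Prod>i=1..d. norm (coef (k i) (s i)) * \<bar>x\<bar> ^ k i)"
  have "G summable_on ({1..d} \<rightarrow>\<^sub>E UNIV)"
    unfolding G_def
  proof (rule summable_on_prod_PiE)
    fix i assume i: "i \<in> {1..d}"
    have "norm (base (tail_sum d s i) 0) < 1"
      by (intro norm_base_lt_1 Re_tail_sum_pos s i)
    \<comment> \<open>The real ratio is regarded as a complex number so that the complex geometric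
      series applies; taking norms returns to the reals.\<close>
    then have "norm (complex_of_real (norm (base (tail_sum d s i) 0))) < 1" by simp
    from geometric_has_sum[OF this q, of "r i"]
    have "(\<lambda>m. complex_of_real (norm (base (tail_sum d s i) 0)) ^ (q * m + r i)) summable_on UNIV"
      by (auto simp: summable_on_def)
    then have "(\<lambda>m. norm (complex_of_real (norm (base (tail_sum d s i) 0)) ^ (q * m + r i))) summable_on UNIV"
      by (subst (asm) summable_on_iff_abs_summable_on_complex)
    then show "(\<lambda>m. norm (base (tail_sum d s i) 0) ^ (q * m + r i)) summable_on UNIV"
      by (simp add: norm_power)
  qed auto
  moreover have "H summable_on ({1..d} \<rightarrow>\<^sub>E UNIV)"
    unfolding H_def by (rule summable_on_prod_PiE) (auto intro!: summable_coef)
  ultimately have GH: "(\<lambda>(m, k). G m * H k) summable_on ({1..d} \<rightarrow>\<^sub>E UNIV) \<times> ({1..d} \<rightarrow>\<^sub>E UNIV)"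
    by (rule summable_on_product) (auto simp: G_def H_def intro!: prod_nonneg)
  have le: "norm (double_term d r s m k) \<le> G m * H k" for m k
  proof -
    have "norm (double_term d r s m k) =
        (\<Prod>j=1..d. norm (coef (k j) (s j)) * (norm (base (s j) 0) ^ index_sum r m j * \<bar>x\<bar> ^ (k j * index_sum r m j)))"
      unfolding double_term_def prod_norm[symmetric]
      by (simp add: norm_mult norm_power norm_base power_mult_distrib power_mult)
    \<comment> \<open>Each index is at least 1, so the exponent of \<open>\<bar>x\<bar>\<close> may
      be lowered to \<open>k j\<close>, which separates \<open>k\<close> from
      \<open>m\<close>.\<close>
    also have "\<dots> \<le> (\<Prod>j=1..d. norm (coef (k j) (s j)) * (norm (base (s j) 0) ^ index_sum r m j * \<bar>x\<bar> ^ k j))"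
    proof (intro prod_mono conjI mult_left_mono power_decreasing)
      fix j assume "j \<in> {1..d}"
      then have "index_sum r m j \<ge> 1" using index_sum_pos[of d r j m] r by blast
      then show "k j \<le> k j * index_sum r m j" by simp
    qed (use x in auto)
    also have "\<dots> = (\<Prod>j=1..d. norm (base (s j) 0) ^ index_sum r m j) * H k"
      unfolding H_def by (simp add: prod.distrib mult_ac)
    also have "(\<Prod>j=1..d. norm (base (s j) 0) ^ index_sum r m j) = G m"
      unfolding index_sum_eq prod_tail_power G_def
      using base_sum[where s = s and k = "\<lambda>_. 0"] by (simp add: prod_norm tail_sum_def)
    finally show ?thesis .
  qed
  have "(\<lambda>p. norm ((\<lambda>(m, k). double_term d r s m k) p)) summable_on ({1..d} \<rightarrow>\<^sub>E UNIV) \<times> ({1..d} \<rightarrow>\<^sub>E UNIV)"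
    by (rule summable_on_comparison_test[OF GH]) (use le in auto)
  then show ?thesis by (rule Infinite_Sum.abs_summable_summable)
qed

lemma infsum_double_term_k:
  assumes "\<And>i. i \<in> {1..d} \<Longrightarrow> r i \<ge> 1"
  shows "(\<Sum>\<^sub>\<infinity>k\<in>{1..d} \<rightarrow>\<^sub>E UNIV. double_term d r s m k) =
    (\<Prod>j=1..d. 1 / of_real (seqU (index_sum r m j)) powr s j)"
proof -
  have has: "((\<lambda>k. coef k (s j) * base (s j) k ^ index_sum r m j) has_sum
      1 / of_real (seqU (index_sum r m j)) powr s j) UNIV" if "j \<in> {1..d}" for j
    by (rule seqU_powr_expansion[OF index_sum_pos[of d r, OF assms that]])
  have "(\<Sum>\<^sub>\<infinity>k\<in>{1..d} \<rightarrow>\<^sub>E UNIV. double_term d r s m k) =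
      (\<Prod>j=1..d. \<Sum>\<^sub>\<infinity>k. coef k (s j) * base (s j) k ^ index_sum r m j)"
    unfolding double_term_def
    by (rule infsum_prod_PiE_abs)
      (use has in \<open>auto simp: summable_on_iff_abs_summable_on_complex[symmetric] summable_on_def\<close>)
  also have "\<dots> = (\<Prod>j=1..d. 1 / of_real (seqU (index_sum r m j)) powr s j)"
    using has by (intro prod.cong infsumI) auto
  finally show ?thesis .
qed

lemma infsum_double_term_m:
  assumes s: "s \<in> convergence_domain d"
  shows "(\<Sum>\<^sub>\<infinity>m\<in>{1..d} \<rightarrow>\<^sub>E UNIV. double_term d r s m k) = zeta_term d r s k"
proof -
  let ?b = "\<lambda>i. base (tail_sum d s i) (tail_sum d k i)"
  have has: "((\<lambda>m. ?b i ^ (q * m + r i)) has_sum (?b i ^ r i / (1 - ?b i ^ q))) UNIV"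
    if "i \<in> {1..d}" for i
    using that by (intro geometric_has_sum norm_base_lt_1 Re_tail_sum_pos s q)
  have "(\<Sum>\<^sub>\<infinity>m\<in>{1..d} \<rightarrow>\<^sub>E UNIV. double_term d r s m k) =
      (\<Prod>j=1..d. coef (k j) (s j)) * (\<Sum>\<^sub>\<infinity>m\<in>{1..d} \<rightarrow>\<^sub>E UNIV. \<Prod>i=1..d. ?b i ^ (q * m i + r i))"
    unfolding double_term_eq by (rule infsum_cmult_right')
  also have "(\<Sum>\<^sub>\<infinity>m\<in>{1..d} \<rightarrow>\<^sub>E UNIV. \<Prod>i=1..d. ?b i ^ (q * m i + r i)) =
      (\<Prod>i=1..d. \<Sum>\<^sub>\<infinity>m. ?b i ^ (q * m + r i))"
    by (rule infsum_prod_PiE_abs)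
      (use has in \<open>auto simp: summable_on_iff_abs_summable_on_complex[symmetric] summable_on_def\<close>)
  also have "\<dots> = (\<Prod>i=1..d. ?b i ^ r i / (1 - ?b i ^ q))"
    using has by (intro prod.cong infsumI) auto
  finally show ?thesis unfolding zeta_term_def prod.distrib .
qed

lemma zeta_series_summable:
  assumes s: "s \<in> convergence_domain d" and r: "\<And>i. i \<in> {1..d} \<Longrightarrow> r i \<ge> 1"
  shows "(\<lambda>m. \<Prod>j=1..d. 1 / of_real (seqU (index_sum r m j)) powr s j) summable_on ({1..d} \<rightarrow>\<^sub>E UNIV)"
  using summable_on_Sigma_banach[OF double_term_summable[of s d r, OF s r]]
  by (simp only: infsum_double_term_k[of d r, OF r])

text \<open>Absolute summability permits both orders: summing over \<open>k\<close> first recovers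
  the Lucas powers, summing over \<open>m\<close> first gives the geometric quotients.\<close>

lemma zeta_series_eq:
  assumes s: "s \<in> convergence_domain d" and r: "\<And>i. i \<in> {1..d} \<Longrightarrow> r i \<ge> 1"
  shows "(\<Sum>\<^sub>\<infinity>m\<in>{1..d} \<rightarrow>\<^sub>E UNIV. \<Prod>j=1..d. 1 / of_real (seqU (index_sum r m j)) powr s j) = zeta_cont d r s"
proof -
  have "(\<Sum>\<^sub>\<infinity>m\<in>{1..d} \<rightarrow>\<^sub>E UNIV. \<Prod>j=1..d. 1 / of_real (seqU (index_sum r m j)) powr s j) =
     (\<Sum>\<^sub>\<infinity>m\<in>{1..d} \<rightarrow>\<^sub>E UNIV. \<Sum>\<^sub>\<infinity>k\<in>{1..d} \<rightarrow>\<^sub>E UNIV. double_term d r s m k)"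
    by (simp only: infsum_double_term_k[of d r, OF r])
  also have "\<dots> = (\<Sum>\<^sub>\<infinity>k\<in>{1..d} \<rightarrow>\<^sub>E UNIV. \<Sum>\<^sub>\<infinity>m\<in>{1..d} \<rightarrow>\<^sub>E UNIV. double_term d r s m k)"
    by (rule infsum_swap_banach[OF double_term_summable[of s d r, OF s r]])
  finally show ?thesis by (simp only: infsum_double_term_m[OF s] zeta_cont_def)
qed

text \<open>Division with remainder of the successive gaps, with remainders taken in \<open>{1..q}\<close>.\<close>

lemma index_sum_bij:
  "bij_betw (\<lambda>(r, m). \<lambda>j\<in>{1..d}. index_sum r m j)
     (({1..d} \<rightarrow>\<^sub>E {1..q}) \<times> ({1..d} \<rightarrow>\<^sub>E UNIV))
     {n \<in> {1..d} \<rightarrow>\<^sub>E {0<..}. strict_mono_on {1..d} n}"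
proof -
  \<comment> \<open>An extensional tuple is \<open>undefined\<close> at 0, hence the separate case
    for the first gap.\<close>
  define gap where "gap = (\<lambda>(n::nat \<Rightarrow> nat) j. n j - (if j = 1 then 0 else n (j - 1)))"
  \<comment> \<open>Subtracting 1 before the division and adding it to the remainder moves the
    remainders from \<open>{0..<q}\<close> to \<open>{1..q}\<close>.\<close>
  define inv where "inv = (\<lambda>n. ((\<lambda>j\<in>{1..d}. (gap n j - 1) mod q + 1), (\<lambda>j\<in>{1..d}. (gap n j - 1) div q)))"
  show ?thesis
  proof (rule bij_betw_byWitness[where f' = inv])
    show "\<forall>p\<in>({1..d} \<rightarrow>\<^sub>E {1..q}) \<times> ({1..d} \<rightarrow>\<^sub>E UNIV).
        inv ((\<lambda>(r, m). \<lambda>j\<in>{1..d}. index_sum r m j) p) = p"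
    proof safe
      fix r m :: "nat \<Rightarrow> nat" assume r: "r \<in> {1..d} \<rightarrow>\<^sub>E {1..q}" and m: "m \<in> {1..d} \<rightarrow>\<^sub>E UNIV"
      have gap: "gap (\<lambda>j\<in>{1..d}. index_sum r m j) j = q * m j + r j" if j: "j \<in> {1..d}" for j
      proof (cases "j = 1")
        case False
        then obtain i where i: "j = Suc i" "i \<ge> 1" using j by (cases j) auto
        then show ?thesis using j by (simp add: gap_def index_sum_eq)
      qed (use j in \<open>simp add: gap_def index_sum_eq\<close>)
      have "(q * m j + r j - 1) mod q + 1 = r j \<and> (q * m j + r j - 1) div q = m j" if "j \<in> {1..d}" for j
      proof -
        have "r j \<ge> 1" "r j \<le> q" using r that by auto
        then have "q * m j + r j - 1 = (r j - 1) + m j * q" "r j - 1 < q"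
          by (auto simp: mult.commute[of q])
        then show ?thesis using q \<open>r j \<ge> 1\<close> by (simp only: mod_mult_self1 div_mult_self1) simp
      qed
      then show "inv (\<lambda>j\<in>{1..d}. index_sum r m j) = (r, m)"
        using r m gap by (auto simp: inv_def PiE_def extensional_def fun_eq_iff)
    qed
    show "\<forall>n\<in>{n \<in> {1..d} \<rightarrow>\<^sub>E {0<..}. strict_mono_on {1..d} n}.
        (\<lambda>(r, m). \<lambda>j\<in>{1..d}. index_sum r m j) (inv n) = n"
    proof
      fix n :: "nat \<Rightarrow> nat" assume "n \<in> {n \<in> {1..d} \<rightarrow>\<^sub>E {0<..}. strict_mono_on {1..d} n}"
      then have n: "n \<in> {1..d} \<rightarrow>\<^sub>E {0<..}" "strict_mono_on {1..d} n" by auto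
      have gap_pos: "gap n j \<ge> 1" if "j \<in> {1..d}" for j
      proof (cases "j = 1")
        case False
        then have "n (j - 1) < n j" using that by (intro strict_mono_onD[OF n(2)]) auto
        then show ?thesis using False by (simp add: gap_def)
      qed (use n that in \<open>force simp: gap_def\<close>)
      have sum_gap: "(\<Sum>i=1..j. gap n i) = n j" if "j \<in> {1..d}" for j
        using that
      proof (induction j)
        case (Suc j)
        show ?case
        proof (cases "j = 0")
          case False
          then have "n j < n (Suc j)" using Suc.prems by (intro strict_mono_onD[OF n(2)]) auto
          then show ?thesis using Suc False by (simp add: gap_def)
        qed (simp add: gap_def)
      qed auto
      have "index_sum (fst (inv n)) (snd (inv n)) j = n j" if j: "j \<in> {1..d}" for j
      proof -
        have "index_sum (fst (inv n)) (snd (inv n)) j = (\<Sum>i=1..j. gap n i)"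
          unfolding index_sum_eq
        proof (intro sum.cong refl)
          fix i assume "i \<in> {1..j}"
          then have i: "i \<in> {1..d}" using j by auto
          have "q * ((gap n i - 1) div q) + (gap n i - 1) mod q = gap n i - 1" by simp
          then show "q * snd (inv n) i + fst (inv n) i = gap n i"
            using gap_pos[OF i] i by (simp add: inv_def)
        qed
        then show ?thesis using sum_gap[OF j] by simp
      qed
      then show "(\<lambda>(r, m). \<lambda>j\<in>{1..d}. index_sum r m j) (inv n) = n"
        using n by (auto simp: case_prod_beta fun_eq_iff PiE_def extensional_def)
    qed
    show "(\<lambda>(r, m). \<lambda>j\<in>{1..d}. index_sum r m j) ` (({1..d} \<rightarrow>\<^sub>E {1..q}) \<times> ({1..d} \<rightarrow>\<^sub>E UNIV))
        \<subseteq> {n \<in> {1..d} \<rightarrow>\<^sub>E {0<..}. strict_mono_on {1..d} n}"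
    proof (rule image_subsetI)
      fix p assume "p \<in> ({1..d} \<rightarrow>\<^sub>E {1..q}) \<times> ({1..d} \<rightarrow>\<^sub>E (UNIV :: nat set))"
      then obtain r m where p: "p = (r, m)" and r: "r \<in> {1..d} \<rightarrow>\<^sub>E {1..q}" by blast
      have r1: "r i \<ge> 1" if "i \<in> {1..d}" for i using r that by auto
      have "index_sum r m j > 0" if "j \<in> {1..d}" for j
        using index_sum_pos[of d r j m] r1 that by fastforce
      moreover have "strict_mono_on {1..d} (\<lambda>j\<in>{1..d}. index_sum r m j)"
      proof (rule strict_mono_onI)
        fix i j assume ij: "i \<in> {1..d}" "j \<in> {1..d}" "i < j"
        \<comment> \<open>Strict because the longer sum contains the term at \<open>j\<close>, which
          is at least \<open>r j > 0\<close>.\<close>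
        have "(\<Sum>l=1..i. q * m l + r l) < (\<Sum>l=1..j. q * m l + r l)"
          using ij r1[of j] by (intro sum_strict_mono2[of _ _ j]) auto
        then show "(\<lambda>j\<in>{1..d}. index_sum r m j) i < (\<lambda>j\<in>{1..d}. index_sum r m j) j"
          using ij by (simp add: index_sum_eq)
      qed
      ultimately show "(\<lambda>(r, m). \<lambda>j\<in>{1..d}. index_sum r m j) p
          \<in> {n \<in> {1..d} \<rightarrow>\<^sub>E {0<..}. strict_mono_on {1..d} n}"
        unfolding p by auto
    qed
    show "inv ` {n \<in> {1..d} \<rightarrow>\<^sub>E {0<..}. strict_mono_on {1..d} n}
        \<subseteq> ({1..d} \<rightarrow>\<^sub>E {1..q}) \<times> ({1..d} \<rightarrow>\<^sub>E UNIV)"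
      using q by (auto simp: inv_def Suc_le_eq)
  qed
qed

text \<open>After reindexing by remainders and quotients of the gaps, periodicity makes the
  coefficients depend on \<open>r\<close> alone, so each fixed \<open>r\<close> contributes a
  shifted zeta series.\<close>

lemma L_series_eq:
  assumes s: "s \<in> convergence_domain d"
    and periodic: "\<And>j r m. j \<in> {1..d} \<Longrightarrow> c j (index_sum r m j) = c j (\<Sum>i=1..j. r i)"
  shows "(\<Sum>\<^sub>\<infinity>n\<in>{n \<in> {1..d} \<rightarrow>\<^sub>E {0<..}. strict_mono_on {1..d} n}. \<Prod>j=1..d. c j (n j) / of_real (seqU (n j)) powr s j)
    = (\<Sum>r\<in>{1..d} \<rightarrow>\<^sub>E {1..q}. (\<Prod>j=1..d. c j (\<Sum>i=1..j. r i)) * zeta_cont d r s)"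
proof -
  let ?I = "{1..d} \<rightarrow>\<^sub>E {1..q}" and ?A = "{1..d} \<rightarrow>\<^sub>E (UNIV :: nat set)"
  define z where "z = (\<lambda>r m. \<Prod>j=1..d. 1 / of_real (seqU (index_sum r m j)) powr s j)"
  define C where "C = (\<lambda>r. \<Prod>j=1..d. c j (\<Sum>i=1..j. r i))"
  have fin: "finite ?I" by (intro finite_PiE) auto
  have r1: "r i \<ge> 1" if "r \<in> ?I" "i \<in> {1..d}" for r i using that by auto
  have z_sum: "(\<lambda>m. C r * z r m) summable_on ?A" if "r \<in> ?I" for r
    unfolding z_def by (intro summable_on_cmult_right zeta_series_summable s r1[OF that])
  \<comment> \<open>There are finitely many remainder tuples, so summability over the product
    reduces to summability in \<open>m\<close> for each \<open>r\<close>.\<close>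
  have summable: "(\<lambda>(r, m). C r * z r m) summable_on ?I \<times> ?A"
  proof -
    have "(\<lambda>p. norm (case p of (r, m) \<Rightarrow> C r * z r m)) summable_on ?I \<times> ?A"
    proof (rule summable_on_SigmaI)
      fix r assume "r \<in> ?I"
      then have "(\<lambda>m. norm (C r * z r m)) summable_on ?A"
        using z_sum by (simp add: summable_on_iff_abs_summable_on_complex)
      then show "((\<lambda>m. norm (case (r, m) of (r, m) \<Rightarrow> C r * z r m)) has_sum (\<Sum>\<^sub>\<infinity>m\<in>?A. norm (C r * z r m))) ?A"
        by simp
    qed (use fin in auto)
    then show ?thesis by (rule Infinite_Sum.abs_summable_summable)
  qed
  have "(\<Sum>\<^sub>\<infinity>n\<in>{n \<in> {1..d} \<rightarrow>\<^sub>E {0<..}. strict_mono_on {1..d} n}. \<Prod>j=1..d. c j (n j) / of_real (seqU (n j)) powr s j)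
      = (\<Sum>\<^sub>\<infinity>p\<in>?I \<times> ?A. \<Prod>j=1..d. c j ((\<lambda>(r, m). \<lambda>j\<in>{1..d}. index_sum r m j) p j) /
            of_real (seqU ((\<lambda>(r, m). \<lambda>j\<in>{1..d}. index_sum r m j) p j)) powr s j)"
    by (rule infsum_reindex_bij_betw[OF index_sum_bij, symmetric])
  also have "\<dots> = (\<Sum>\<^sub>\<infinity>p\<in>?I \<times> ?A. (\<lambda>(r, m). C r * z r m) p)"
    by (rule infsum_cong) (auto simp: z_def C_def prod.distrib[symmetric] periodic intro!: prod.cong)
  also have "\<dots> = (\<Sum>\<^sub>\<infinity>r\<in>?I. \<Sum>\<^sub>\<infinity>m\<in>?A. C r * z r m)"
    using infsum_Sigma'_banach[OF summable] by simp
  also have "\<dots> = (\<Sum>r\<in>?I. C r * zeta_cont d r s)"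
    unfolding infsum_finite[OF fin] infsum_cmult_right' z_def
    by (intro sum.cong refl arg_cong2[where f = "(*)"] zeta_series_eq[OF s]) (use r1 in blast)
  finally show ?thesis by (simp add: C_def)
qed

end

subsection \<open>The residue\<close>

lemma tail_sum_last: "tail_sum d s d = s d"
  by (simp add: tail_sum_def)

lemma tail_sum_upd_last:
  assumes "i \<in> {1..d - 1}"
  shows "tail_sum d (s(d := c)) i = tail_sum (d - 1) s i + c"
proof -
  obtain e where d: "d = Suc e" using assms by (cases d) auto
  have "(\<Sum>j=i..e. (s(d := c)) j) = (\<Sum>j=i..e. s j)" by (intro sum.cong) (auto simp: d)
  then show ?thesis using assms by (simp add: tail_sum_def d)
qed

lemma prod_split_last:
  fixes f :: "nat \<Rightarrow> 'a::comm_monoid_mult"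
  assumes "d \<ge> 1"
  shows "(\<Prod>i=1..d. f i) = (\<Prod>i=1..d - 1. f i) * f d"
  using assms by (cases d) simp_all

context lucas_expansion
begin

text \<open>The value at \<open>a\<close> is the derivative of \<open>1 - base z k ^ q\<close> there
  when \<open>base a k ^ q = 1\<close>; it removes the singularity of the quotient.\<close>

definition pole_quotient :: "complex \<Rightarrow> nat \<Rightarrow> complex \<Rightarrow> complex" where
  "pole_quotient a k z = (if z = a then of_nat q * of_real lam else (1 - base z k ^ q) / (z - a))"

text \<open>At a pole this is \<open>zeta_den\<close> divided by \<open>s d - a\<close>, in a form
  that remains meaningful on the hyperplane itself; see \<open>zeta_den_factor\<close>.\<close>

definition residue_den :: "nat \<Rightarrow> nat \<Rightarrow> complex \<Rightarrow> nat \<Rightarrow> (nat \<Rightarrow> complex) \<Rightarrow> complex" where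
  "residue_den d M a k s = (\<Prod>i=1..d - 1. pole_factor M (tail_sum d s i)) *
     ((\<Prod>K\<in>{..M} - {k}. 1 - base (s d) K ^ q) * pole_quotient a k (s d))"

context
  fixes a :: complex and k :: nat
  assumes pole: "base a k ^ q = 1"
begin

text \<open>The norms of \<open>base a K\<close> for different \<open>K\<close> differ by powers of
  \<open>\<bar>x\<bar>\<close>, which is neither 0 nor 1, so only one of them can be 1.\<close>

lemma base_pole_other:
  assumes "K \<noteq> k"
  shows "1 - base a K ^ q \<noteq> 0"
proof
  assume "1 - base a K ^ q = 0"
  then have "norm (base a K) ^ q = 1" by (metis norm_one norm_power right_minus_eq)
  moreover have "norm (base a k) ^ q = 1" using pole by (metis norm_one norm_power)
  ultimately have "norm (base a K) = norm (base a k)"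
    using q by (metis norm_ge_zero power_eq_imp_eq_base not_one_le_zero zero_less_iff_neq_zero)
  then have "\<bar>x\<bar> ^ K = \<bar>x\<bar> ^ k" by (simp add: norm_base)
  then show False using assms x power_inject_exp'[of "\<bar>x\<bar>" K k] by auto
qed

lemma holomorphic_pole_quotient: "pole_quotient a k holomorphic_on S"
proof -
  let ?f = "\<lambda>z. 1 - base z k ^ q"
  have hol: "?f holomorphic_on UNIV"
    by (intro holomorphic_on_diff holomorphic_on_const holomorphic_on_power holomorphic_base)
  have "(?f has_field_derivative - (of_nat q * (- of_real lam * base a k) * base a k ^ (q - 1))) (at a)"
    unfolding base_def by (auto intro!: derivative_eq_intros simp: mult_ac)
  \<comment> \<open>The powers of \<open>base a k\<close> combine to the exponent \<open>q\<close>
    and disappear by the pole condition.\<close>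
  also have "- (of_nat q * (- of_real lam * base a k) * base a k ^ (q - 1)) = of_nat q * of_real lam"
    using pole q power_minus_mult[of q "base a k"] by (simp add: mult_ac)
  finally have "deriv ?f a = of_nat q * of_real lam" by (rule DERIV_imp_deriv)
  then have "pole_quotient a k = (\<lambda>z. if z = a then deriv ?f a else (?f z - ?f a) / (z - a))"
    using pole by (auto simp: pole_quotient_def fun_eq_iff)
  then have "pole_quotient a k holomorphic_on UNIV" using pole_lemma[OF hol, of a] by simp
  then show ?thesis by (rule holomorphic_on_subset) auto
qed

lemma mv_holomorphic_residue_den: "mv_holomorphic d V (residue_den d M a k)"
  unfolding residue_den_def
proof (intro mv_holomorphic_mult mv_holomorphic_prod)
  show "mv_holomorphic d V (\<lambda>s. pole_factor M (tail_sum d s i))" for i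
    by (rule mv_holomorphic_compose[OF mv_holomorphic_tail_sum holomorphic_pole_factor[of _ UNIV]]) auto
  have "(\<lambda>z. 1 - base z K ^ q) holomorphic_on UNIV" for K
    by (intro holomorphic_on_diff holomorphic_on_const holomorphic_on_power holomorphic_base)
  from mv_holomorphic_compose[OF mv_holomorphic_coord this]
  show "mv_holomorphic d V (\<lambda>s. 1 - base (s d) K ^ q)" for K by auto
  show "mv_holomorphic d V (\<lambda>s. pole_quotient a k (s d))"
    by (rule mv_holomorphic_compose[OF mv_holomorphic_coord holomorphic_pole_quotient[of UNIV]]) auto
qed

lemma zeta_den_factor:
  assumes "d \<ge> 1" "k \<le> M"
  shows "zeta_den d M s = (s d - a) * residue_den d M a k s"
proof -
  have "pole_factor M (s d) = (1 - base (s d) k ^ q) * (\<Prod>K\<in>{..M} - {k}. 1 - base (s d) K ^ q)"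
    unfolding pole_factor_def using assms(2) by (intro prod.remove) auto
  moreover have "1 - base (s d) k ^ q = (s d - a) * pole_quotient a k (s d)"
    using pole by (auto simp: pole_quotient_def)
  ultimately show ?thesis
    unfolding zeta_den_def residue_den_def prod_split_last[OF assms(1)]
    by (simp add: tail_sum_last mult_ac)
qed

text \<open>Provides the point needed to show that the denominator does not vanish identically on
  any open piece of the hyperplane.\<close>

lemma residue_den_nonzero:
  assumes d: "d \<ge> 1"
  shows "\<exists>s\<in>cspace (d - 1). residue_den d M a k (s(d := a)) \<noteq> 0"
proof
  \<comment> \<open>Large enough that every tail sum keeps a positive real part after
    \<open>a\<close> is added.\<close>
  define t where "t = \<bar>Re a\<bar> + 1"
  define s where "s = (\<lambda>j. if j \<in> {1..d - 1} then complex_of_real t else undefined)"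
  show "s \<in> cspace (d - 1)" by (auto simp: s_def cspace_def PiE_iff extensional_def)
  have "pole_factor M (tail_sum d (s(d := a)) i) \<noteq> 0" if i: "i \<in> {1..d - 1}" for i
  proof -
    have "t \<le> (\<Sum>j=i..d - 1. t)"
      using i mult_right_mono[of 1 "real (Suc (d - 1) - i)" t] by (simp add: t_def)
    also have "\<dots> = (\<Sum>j=i..d - 1. Re (s j))"
      using i by (intro sum.cong) (auto simp: s_def)
    finally have "Re (tail_sum d (s(d := a)) i) > 0"
      unfolding tail_sum_upd_last[OF i] by (simp add: tail_sum_def t_def)
    then show ?thesis
      unfolding pole_factor_def using norm_base_lt_1 one_minus_base_nonzero by auto
  qed
  moreover have "pole_quotient a k a \<noteq> 0" using lam q by (simp add: pole_quotient_def)
  ultimately show "residue_den d M a k (s(d := a)) \<noteq> 0"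
    using base_pole_other by (auto simp: residue_den_def)
qed

text \<open>On the hyperplane only the terms with last index \<open>k\<close> survive. In them every
  base acquires the factor \<open>base a k\<close>, which drops out of the \<open>q\<close>-th
  powers and collects in the numerators to the exponent \<open>r 1 + ... + r d\<close>.\<close>

lemma zeta_num_hyperplane:
  assumes d: "d \<ge> 1" and k: "k \<le> M" and nz: "residue_den d M a k (s(d := a)) \<noteq> 0"
  shows "zeta_num d r M (s(d := a)) / residue_den d M a k (s(d := a)) =
    zeta_cont (d - 1) r s * (coef k a * base a k ^ (\<Sum>i=1..d. r i) / (of_nat q * of_real lam))"
proof -
  let ?s = "s(d := a)"
  let ?p = "\<Prod>i=1..d - 1. pole_factor M (tail_sum d ?s i)"
  let ?e = "\<Prod>K\<in>{..M} - {k}. 1 - base a K ^ q"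
  let ?A = "{1..d - 1} \<rightarrow>\<^sub>E (UNIV :: nat set)"
  have factor_nz: "pole_factor M (tail_sum d ?s i) \<noteq> 0" if "i \<in> {1..d - 1}" for i
    using nz that by (auto simp: residue_den_def)
  have zero: "num_term d r M ?s \<kappa> = 0" if "\<kappa> d \<noteq> k" for \<kappa>
  proof -
    \<comment> \<open>The vanishing factor with index \<open>k\<close> is still in the product,
      since only the index \<open>\<kappa> d\<close> has been removed.\<close>
    have "regular M a (\<kappa> d) = 0"
      using that k pole by (auto simp: regular_def)
    then show ?thesis
      unfolding num_term_def prod_split_last[OF d] by (simp add: tail_sum_last)
  qed
  have eq: "num_term d r M ?s (\<kappa>(d := k)) =
      zeta_term (d - 1) r s \<kappa> * (coef k a * base a k ^ (\<Sum>i=1..d. r i) * (?p * ?e))" for \<kappa>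
  proof -
    have "coef ((\<kappa>(d := k)) i) (?s i) * (base (tail_sum d ?s i) (tail_sum d (\<kappa>(d := k)) i) ^ r i *
             regular M (tail_sum d ?s i) (tail_sum d (\<kappa>(d := k)) i)) =
          (coef (\<kappa> i) (s i) * (base (tail_sum (d - 1) s i) (tail_sum (d - 1) \<kappa> i) ^ r i /
             (1 - base (tail_sum (d - 1) s i) (tail_sum (d - 1) \<kappa> i) ^ q))) *
          (base a k ^ r i * pole_factor M (tail_sum d ?s i))" if i: "i \<in> {1..d - 1}" for i
    proof -
      have "i \<noteq> d" using i by auto
      then show ?thesis
        using pole unfolding regular_eq[OF factor_nz[OF i]]
        by (simp add: tail_sum_upd_last[OF i] base_add power_mult_distrib)
    qed
    then have "num_term d r M ?s (\<kappa>(d := k)) =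
      (\<Prod>i=1..d - 1. (coef (\<kappa> i) (s i) * (base (tail_sum (d - 1) s i) (tail_sum (d - 1) \<kappa> i) ^ r i /
             (1 - base (tail_sum (d - 1) s i) (tail_sum (d - 1) \<kappa> i) ^ q))) *
          (base a k ^ r i * pole_factor M (tail_sum d ?s i))) * (coef k a * (base a k ^ r d * ?e))"
      unfolding num_term_def prod_split_last[OF d] using k
      by (simp add: tail_sum_last regular_def)
    also have "\<dots> = zeta_term (d - 1) r s \<kappa> * (\<Prod>i=1..d - 1. base a k ^ r i) * ?p * (coef k a * (base a k ^ r d * ?e))"
      unfolding zeta_term_def prod.distrib by (simp add: mult_ac)
    also have "\<dots> = zeta_term (d - 1) r s \<kappa> *
        (coef k a * ((\<Prod>i=1..d - 1. base a k ^ r i) * base a k ^ r d) * (?p * ?e))"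
      by (simp only: mult_ac)
    also have "(\<Prod>i=1..d - 1. base a k ^ r i) * base a k ^ r d = base a k ^ (\<Sum>i=1..d. r i)"
      using prod_split_last[OF d, of "\<lambda>i. base a k ^ r i"] by (simp add: power_sum)
    finally show ?thesis .
  qed
  have inj: "inj_on (\<lambda>\<kappa>. \<kappa>(d := k)) ?A"
  proof (rule inj_onI)
    fix f g assume *: "f \<in> ?A" "g \<in> ?A" "f(d := k) = g(d := k)"
    have "f i = g i" for i
    proof (cases "i = d")
      case True
      then have "i \<notin> {1..d - 1}" using d by auto
      then show ?thesis using * by (auto simp: PiE_def extensional_def)
    next
      case False
      then show ?thesis using * by (metis fun_upd_other)
    qed
    then show "f = g" by auto
  qed
  have "zeta_num d r M ?s = (\<Sum>\<^sub>\<infinity>\<kappa>\<in>(\<lambda>\<kappa>. \<kappa>(d := k)) ` ?A. num_term d r M ?s \<kappa>)"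
    unfolding zeta_num_def
  proof (rule infsum_cong_neutral)
    fix \<kappa> assume \<kappa>: "\<kappa> \<in> ({1..d} \<rightarrow>\<^sub>E UNIV) - (\<lambda>\<kappa>. \<kappa>(d := k)) ` ?A"
    have "\<kappa> d \<noteq> k"
    proof
      assume "\<kappa> d = k"
      then have "\<kappa> = (\<kappa>(d := undefined))(d := k)" by auto
      moreover have "\<kappa>(d := undefined) \<in> ?A"
        using \<kappa> by (auto simp: PiE_def extensional_def)
      ultimately show False using \<kappa> by blast
    qed
    then show "num_term d r M ?s \<kappa> = 0" by (rule zero)
  next
    fix \<kappa> assume "\<kappa> \<in> (\<lambda>\<kappa>. \<kappa>(d := k)) ` ?A - ({1..d} \<rightarrow>\<^sub>E UNIV)"
    then show "num_term d r M ?s \<kappa> = 0" using d by (auto simp: PiE_def extensional_def)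
  qed auto
  also have "\<dots> = (\<Sum>\<^sub>\<infinity>\<kappa>\<in>?A. num_term d r M ?s (\<kappa>(d := k)))"
    by (subst infsum_reindex[OF inj]) (simp add: o_def)
  also have "\<dots> = zeta_cont (d - 1) r s * (coef k a * base a k ^ (\<Sum>i=1..d. r i) * (?p * ?e))"
    unfolding eq zeta_cont_def by (rule infsum_cmult_left')
  finally have num: "zeta_num d r M ?s = zeta_cont (d - 1) r s * (coef k a * base a k ^ (\<Sum>i=1..d. r i) * (?p * ?e))" .
  have den: "residue_den d M a k ?s = (?p * ?e) * (of_nat q * of_real lam)"
    by (simp add: residue_den_def pole_quotient_def mult_ac)
  have "?p * ?e \<noteq> 0" using nz unfolding den by auto
  then show ?thesis unfolding num den by simp
qed

text \<open>One pair of numerator and denominator represents \<open>(s d - a) * F s\<close> near the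
  hyperplane and, after restriction, represents \<open>R\<close>.\<close>

lemma has_hyperplane_residue_zeta_cont:
  assumes d: "d \<ge> 1" and r: "\<And>r i. r \<in> I \<Longrightarrow> i \<in> {1..d} \<Longrightarrow> r i \<ge> 1"
    and F: "generically_equal d (cspace d) F (\<lambda>s. \<Sum>r\<in>I. c r * zeta_cont d r s)"
    and R: "generically_equal (d - 1) (cspace (d - 1)) R
      (\<lambda>s. \<Sum>r\<in>I. c r * (zeta_cont (d - 1) r s *
         (coef k a * base a k ^ (\<Sum>i=1..d. r i) / (of_nat q * of_real lam))))"
  shows "has_hyperplane_residue d a F R"
  unfolding has_hyperplane_residue_def has_hyperplane_restriction_def
proof
  fix p assume p: "p \<in> cspace (d - 1)"
  \<comment> \<open>The radius exceeds |a| too, so the slice of the polydisc by the hyperplane is a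
    polydisc of the same radius one dimension lower.\<close>
  define B where "B = (\<Sum>j\<in>{1..d}. norm ((p(d := a)) j)) + 1"
  have B: "norm ((p(d := a)) j) < B" if "j \<in> {1..d}" for j
    using member_le_sum[of j "{1..d}" "\<lambda>j. norm ((p(d := a)) j)"] that by (auto simp: B_def)
  obtain M0 where "\<And>M. M \<ge> M0 \<Longrightarrow> admissible (of_nat d * B) M" using admissible_exists by blast
  \<comment> \<open>\<open>M\<close> must also reach \<open>k\<close>, so that the factor vanishing
    at \<open>a\<close> is among those of the pole factor.\<close>
  then obtain M where M: "admissible (of_nat d * B) M" "k \<le> M" by (meson max.cobounded1 max.cobounded2)
  let ?V = "polydisc d (\<lambda>_. 0) B"
  let ?V' = "{s \<in> cspace (d - 1). s(d := a) \<in> ?V}"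
  let ?g = "\<lambda>s. \<Sum>r\<in>I. c r * zeta_num d r M s"
  let ?h = "residue_den d M a k"
  have upd: "s(d := z) \<in> cspace d" if "s \<in> cspace (d - 1)" for s z
    using that d by (auto simp: cspace_def PiE_iff extensional_def)
  have "norm a < B" using B[of d] d by simp
  then have V'_eq: "?V' = polydisc (d - 1) (\<lambda>_. 0) B"
  proof (intro equalityI subsetI)
    fix s assume s: "s \<in> polydisc (d - 1) (\<lambda>_. 0) B"
    have "norm ((s(d := a)) j) < B" if "j \<in> {1..d}" for j
      using s that \<open>norm a < B\<close> by (cases "j = d") (auto simp: polydisc_0)
    then show "s \<in> ?V'" using s upd by (auto simp: polydisc_0)
  next
    fix s assume s: "s \<in> ?V'"
    have "norm (s j) < B" if "j \<in> {1..d - 1}" for j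
    proof -
      have "j \<in> {1..d}" "j \<noteq> d" using that by auto
      then show ?thesis using s unfolding mem_Collect_eq polydisc_0 by (metis fun_upd_other)
    qed
    then show "s \<in> polydisc (d - 1) (\<lambda>_. 0) B" using s by (auto simp: polydisc_0)
  qed
  have V': "openin (top_of_set (cspace (d - 1))) ?V'" unfolding V'_eq by (rule openin_polydisc)
  have hol_g: "mv_holomorphic d ?V ?g"
    by (intro mv_holomorphic_sum mv_holomorphic_mult mv_holomorphic_const mv_holomorphic_zeta_num M r)
  obtain s0 where s0: "s0 \<in> cspace (d - 1)" "?h (s0(d := a)) \<noteq> 0"
    using residue_den_nonzero[OF d] by blast
  have "open_dense_in d ?V {s \<in> ?V. ?h s \<noteq> 0}"
    by (rule open_dense_in_nonzero[OF mv_holomorphic_residue_den upd[OF s0(1)] s0(2) openin_polydisc])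
  then have dense: "?V \<subseteq> closure {s \<in> ?V. ?h s \<noteq> 0}" by (simp add: open_dense_in_def)
  have "mv_holomorphic (d - 1) {s \<in> cspace (d - 1). s(d := a) \<in> cspace d} (\<lambda>s. ?h (s(d := a)))"
    by (rule mv_holomorphic_hyperplane[OF mv_holomorphic_residue_den d])
  moreover have "{s \<in> cspace (d - 1). s(d := a) \<in> cspace d} = cspace (d - 1)" using upd by auto
  ultimately have hol_h: "mv_holomorphic (d - 1) (cspace (d - 1)) (\<lambda>s. ?h (s(d := a)))"
    by simp
  have dense': "open_dense_in (d - 1) ?V' {s \<in> ?V'. ?h (s(d := a)) \<noteq> 0}"
    by (rule open_dense_in_nonzero[OF hol_h s0 V'])
  have "generically_equal d ?V (\<lambda>s. (s d - a) * F s) (\<lambda>s. ?g s / ?h s)"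
  proof (rule generically_equal_trans[OF openin_polydisc])
    show "generically_equal d ?V (\<lambda>s. (s d - a) * F s) (\<lambda>s. (s d - a) * (\<Sum>r\<in>I. c r * zeta_cont d r s))"
      by (intro generically_equal_compose[where c = "\<lambda>s z. (s d - a) * z"]
            generically_equal_subset[OF _ openin_polydisc polydisc_subset_cspace F]) simp
    \<comment> \<open>Where \<open>zeta_den\<close> is nonzero, \<open>s d\<close> differs from
      \<open>a\<close> and the linear factor cancels.\<close>
    have "(s d - a) * (\<Sum>r\<in>I. c r * zeta_cont d r s) = ?g s / ?h s" if "zeta_den d M s \<noteq> 0" for s
      using that unfolding zeta_num_eq[OF that] zeta_den_factor[OF d M(2)]
      by (auto simp: sum_distrib_left sum_divide_distrib intro!: sum.cong)
    then show "generically_equal d ?V (\<lambda>s. (s d - a) * (\<Sum>r\<in>I. c r * zeta_cont d r s)) (\<lambda>s. ?g s / ?h s)"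
      using open_dense_in_zeta_den[OF openin_polydisc, of d "\<lambda>_. 0" B M]
      unfolding generically_equal_iff by blast
  qed
  then have 1: "quotient_on d ?V (\<lambda>s. (s d - a) * F s) ?g ?h"
    unfolding quotient_on_def using openin_polydisc hol_g mv_holomorphic_residue_den dense by blast
  have "generically_equal (d - 1) ?V' R (\<lambda>s. ?g (s(d := a)) / ?h (s(d := a)))"
  proof (rule generically_equal_trans[OF V'])
    show "generically_equal (d - 1) ?V' R (\<lambda>s. \<Sum>r\<in>I. c r * (zeta_cont (d - 1) r s *
         (coef k a * base a k ^ (\<Sum>i=1..d. r i) / (of_nat q * of_real lam))))"
      by (rule generically_equal_subset[OF _ V' _ R]) auto
    have "(\<Sum>r\<in>I. c r * (zeta_cont (d - 1) r s *
         (coef k a * base a k ^ (\<Sum>i=1..d. r i) / (of_nat q * of_real lam)))) = ?g (s(d := a)) / ?h (s(d := a))"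
      if "?h (s(d := a)) \<noteq> 0" for s
      unfolding zeta_num_hyperplane[OF d M(2) that, symmetric] by (simp add: sum_divide_distrib)
    then show "generically_equal (d - 1) ?V' (\<lambda>s. \<Sum>r\<in>I. c r * (zeta_cont (d - 1) r s *
         (coef k a * base a k ^ (\<Sum>i=1..d. r i) / (of_nat q * of_real lam))))
        (\<lambda>s. ?g (s(d := a)) / ?h (s(d := a)))"
      using dense' unfolding generically_equal_iff by blast
  qed
  then have 2: "quotient_on (d - 1) ?V' R (\<lambda>s. ?g (s(d := a))) (\<lambda>s. ?h (s(d := a)))"
    unfolding quotient_on_def using V' dense' mv_holomorphic_hyperplane[OF hol_g d]
      mv_holomorphic_hyperplane[OF mv_holomorphic_residue_den d] by (auto simp: open_dense_in_def)
  have "p(d := a) \<in> ?V" using B upd[OF p] by (auto simp: polydisc_0)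
  with 1 2 show "\<exists>V g h. p(d := a) \<in> V \<and> quotient_on d V (\<lambda>s. (s d - a) * F s) g h \<and>
      quotient_on (d - 1) {s \<in> cspace (d - 1). s(d := a) \<in> V} R (\<lambda>s. g (s(d := a))) (\<lambda>s. h (s(d := a)))"
    by blast
qed

end

end

section \<open>The Lucas parameters and the passage to Lucas functions\<close>

lemma lucas_params_facts:
  assumes "lucas_params P Q"
  shows "lucas_D P Q > 0" "lucas_alpha P Q > 1" "\<bar>lucas_beta P Q\<bar> < lucas_alpha P Q"
    "lucas_alpha P Q * lucas_beta P Q = Q" "lucas_alpha P Q - lucas_beta P Q = sqrt (lucas_D P Q)"
proof -
  note par = assms[unfolded lucas_params_def]
  \<comment> \<open>Completing the square at \<open>P = 2\<close> expresses the discriminant through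
    \<open>P - 1 - Q\<close>, whose sign is controlled by the hypotheses.\<close>
  have D_eq: "lucas_D P Q = (P - 2)\<^sup>2 + 4 * (P - 1 - Q)"
    by (simp add: lucas_D_def power2_eq_square algebra_simps)
  show D: "lucas_D P Q > 0"
  proof (cases "P \<le> 2")
    case False
    then have "(P - 2)\<^sup>2 > 0" "P - 1 - Q \<ge> 0" using par by auto
    then show ?thesis unfolding D_eq by (intro add_pos_nonneg) auto
  qed (use par in \<open>auto simp: D_eq add_nonneg_pos\<close>)
  have sqrt_ge: "sqrt (lucas_D P Q) \<ge> \<bar>P - 2\<bar>"
    using par by (intro real_le_rsqrt) (auto simp: D_eq)
  \<comment> \<open>For \<open>P \<le> 2\<close> strictness comes from the square root exceeding
    \<open>2 - P\<close>; for \<open>P > 2\<close> the weak bound already gives \<alpha> at least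
    \<open>P - 1 > 1\<close>.\<close>
  show "lucas_alpha P Q > 1"
  proof (cases "P \<le> 2")
    case True
    then have "sqrt (lucas_D P Q) > \<bar>P - 2\<bar>"
      using par by (intro real_less_rsqrt) (auto simp: D_eq power2_commute[of 2 P])
    then show ?thesis by (simp add: lucas_alpha_def field_simps)
  qed (use sqrt_ge in \<open>simp add: lucas_alpha_def field_simps\<close>)
  show "\<bar>lucas_beta P Q\<bar> < lucas_alpha P Q"
    using par D by (auto simp: lucas_alpha_def lucas_beta_def abs_if field_simps)
  show "lucas_alpha P Q * lucas_beta P Q = Q"
    using D by (simp add: lucas_alpha_def lucas_beta_def lucas_D_def power2_eq_square field_simps
        flip: real_sqrt_mult)
  show "lucas_alpha P Q - lucas_beta P Q = sqrt (lucas_D P Q)"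
    by (simp add: lucas_alpha_def lucas_beta_def field_simps)
qed

lemma dirichlet_character_periodic:
  assumes "dirichlet_character q chi"
  shows "chi (int (q * m + n)) = chi (int n)"
proof (induction m)
  case (Suc m)
  have "int (q * Suc m + n) = int (q * m + n) + int q" by simp
  then show ?case using Suc assms unfolding dirichlet_character_def by metis
qed simp

theorem theorem8:
  fixes P Q :: real and d q k :: nat and n :: int
    and chi :: "nat \<Rightarrow> int \<Rightarrow> complex" and a :: complex
  assumes "lucas_params P Q"
    and "d \<ge> 1" and "q \<ge> 2"
    and "\<And>j. j \<in> {1..d} \<Longrightarrow> dirichlet_character q (chi j)"
    and "a = lucas_pole P Q q n k"
  shows "has_hyperplane_residue d a (lucas_L P Q d chi)
    (\<lambda>s. \<Sum>r\<in>{1..d} \<rightarrow>\<^sub>E {1..q}.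
       (\<Prod>j=1..d. chi j (int (\<Sum>i=1..j. r i)))
       * lucas_zeta P Q q (d - 1) r s
       * complex_of_real (lucas_D P Q) powr (a / 2)
       * ((- a) gchoose k)
       * ((- 1) ^ k / (of_nat q * complex_of_real (ln (lucas_alpha P Q))))
       * zeta_root q powi (- n * int (\<Sum>i=1..d. r i)))"
proof -
  note facts = lucas_params_facts[OF assms(1)]
  define \<alpha> \<beta> where "\<alpha> = lucas_alpha P Q" and "\<beta> = lucas_beta P Q"
  define lam x \<delta> where "lam = ln \<alpha>" and "x = \<beta> / \<alpha>" and "\<delta> = ln (lucas_D P Q)"
  have \<alpha>: "\<alpha> > 1" and \<beta>: "\<bar>\<beta>\<bar> < \<alpha>" and \<alpha>\<beta>: "\<alpha> * \<beta> = Q" and diff: "\<alpha> - \<beta> = sqrt (lucas_D P Q)"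
    using facts by (auto simp: \<alpha>_def \<beta>_def)
  have Q: "Q \<noteq> 0" using assms(1) by (simp add: lucas_params_def)
  interpret lucas_expansion lam x \<delta> q
  proof
    show "lam > 0" using \<alpha> by (simp add: lam_def)
    show "x \<noteq> 0" using Q \<alpha>\<beta> \<alpha> by (auto simp: x_def)
    show "\<bar>x\<bar> < 1" using \<alpha> \<beta> by (simp add: x_def field_simps)
    show "q \<ge> 1" using assms(3) by simp
  qed
  have U: "lucas_U P Q N = seqU N" for N
  proof -
    have "exp (\<delta> / 2) = sqrt (lucas_D P Q)"
      using facts(1) by (simp add: \<delta>_def ln_sqrt[symmetric])
    moreover have "exp (lam * N) = \<alpha> ^ N"
      using \<alpha> by (simp add: lam_def mult.commute exp_of_nat_mult)
    ultimately have e: "exp (lam * N - \<delta> / 2) = \<alpha> ^ N / sqrt (lucas_D P Q)"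
      by (simp add: exp_diff)
    then show ?thesis
      using \<alpha> facts(1) unfolding lucas_U_def seqU_def \<alpha>_def[symmetric] \<beta>_def[symmetric] diff e
      by (simp add: x_def power_divide field_simps)
  qed
  have root: "base a k = zeta_root q powi (- n)"
  proof -
    \<comment> \<open>Since |x| equals |Q| divided by the square of \<alpha>, the part of
      \<open>lam * a\<close> without the imaginary terms is
      \<open>k * ln \<bar>x\<bar>\<close>.\<close>
    have "ln \<bar>Q\<bar> = ln \<alpha> + ln \<bar>\<beta>\<bar>"
      unfolding \<alpha>\<beta>[symmetric] abs_mult using \<alpha> Q \<alpha>\<beta> by (subst ln_mult) auto
    moreover have "ln \<bar>x\<bar> = ln \<bar>\<beta>\<bar> - ln \<alpha>"
      using \<alpha> Q \<alpha>\<beta> by (auto simp: x_def abs_divide ln_div)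
    ultimately have lnx: "ln \<bar>Q\<bar> - 2 * lam = ln \<bar>x\<bar>" by (simp add: lam_def)
    have "of_real lam * a = of_nat k * of_real (ln \<bar>Q\<bar> - 2 * lam) +
        (2 * of_int n / of_nat q + of_nat (lucas_ell Q k)) * (of_real pi * \<i>)"
      unfolding assms(5) lucas_pole_def \<alpha>_def[symmetric] lam_def[symmetric]
      using lam by (simp add: algebra_simps)
    then have "- (of_real lam * a) = of_nat k * of_real (- ln \<bar>x\<bar>) + of_nat (lucas_ell Q k) * (- (of_real pi * \<i>)) +
        of_int (- n) * (2 * of_real pi * \<i> / of_nat q)"
      unfolding lnx by (simp add: algebra_simps)
    then have "exp (- (of_real lam * a)) = exp (of_real (- ln \<bar>x\<bar>)) ^ k * exp (- (of_real pi * \<i>)) ^ lucas_ell Q k *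
        zeta_root q powi (- n)"
      unfolding zeta_root_def exp_power_int by (simp only: exp_add exp_of_nat_mult)
    also have "exp (of_real (- ln \<bar>x\<bar>)) = (of_real (inverse \<bar>x\<bar>) :: complex)"
      unfolding exp_of_real using x by (simp add: exp_minus)
    also have "exp (- (of_real pi * \<i>)) = - 1"
      by (simp add: exp_minus)
    finally have e: "exp (- (of_real lam * a)) =
        of_real (inverse \<bar>x\<bar>) ^ k * (- 1) ^ lucas_ell Q k * zeta_root q powi (- n)" .
    have sgn: "Q > 0 \<longleftrightarrow> x > 0"
      using \<alpha> \<alpha>\<beta> by (auto simp: x_def zero_less_mult_iff zero_less_divide_iff)
    \<comment> \<open>For negative \<open>Q\<close> the extra imaginary term in the pole supplies
      the sign \<open>(- 1) ^ k\<close>, which cancels the sign of \<open>x ^ k\<close>.\<close>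
    have "(of_real (inverse \<bar>x\<bar>) ^ k * (- 1) ^ lucas_ell Q k * of_real x ^ k :: complex) = 1"
    proof (cases "x > 0")
      case True
      then show ?thesis using sgn by (simp add: lucas_ell_def flip: power_mult_distrib)
    next
      case False
      then have "inverse \<bar>x\<bar> * - 1 * x = 1" using x by (simp add: field_simps)
      then have "(of_real (inverse \<bar>x\<bar>) * - 1 * of_real x :: complex) = 1"
        by (metis of_real_1 of_real_minus of_real_mult)
      then show ?thesis using False sgn by (simp add: lucas_ell_def flip: power_mult_distrib)
    qed
    then show ?thesis unfolding base_def e by (simp add: mult_ac)
  qed
  have pole: "base a k ^ q = 1"
  proof -
    have "base a k = exp (of_int (- n) * (2 * of_real pi * \<i> / of_nat q))"
      unfolding root zeta_root_def exp_power_int ..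
    then have "base a k ^ q = exp (of_nat q * (of_int (- n) * (2 * of_real pi * \<i> / of_nat q)))"
      by (simp only: exp_of_nat_mult)
    also have "of_nat q * (of_int (- n) * (2 * of_real pi * \<i> / of_nat q)) = 2 * of_int (- n) * of_real pi * \<i>"
      using q by (simp add: field_simps)
    also have "exp \<dots> = 1" using exp_integer_2pi[of "of_int (- n)"] by simp
    finally show ?thesis .
  qed
  let ?I = "{1..d} \<rightarrow>\<^sub>E {1..q}"
  let ?c = "\<lambda>r. \<Prod>j=1..d. chi j (int (\<Sum>i=1..j. r i))"
  have fin: "finite ?I" by (intro finite_PiE) auto
  have r1: "r i \<ge> 1" if "r \<in> ?I" "i \<in> {1..d}" for r i using that by auto
  have nonempty: "convergence_domain e \<noteq> {}" for e using convergence_domain_nonempty by blast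
  have L: "generically_equal d (cspace d) (lucas_L P Q d chi) (\<lambda>s. \<Sum>r\<in>?I. ?c r * zeta_cont d r s)"
    unfolding lucas_L_def
  proof (rule meromorphic_continuation_generically_equal[OF openin_convergence_domain nonempty])
    show "mv_meromorphic d (\<lambda>s. \<Sum>r\<in>?I. ?c r * zeta_cont d r s)"
      by (rule mv_meromorphic_zeta_cont) (rule r1)
    fix s assume s: "s \<in> convergence_domain d"
    have per: "chi j (int (index_sum r m j)) = chi j (int (\<Sum>i=1..j. r i))" if "j \<in> {1..d}" for j r m
      unfolding index_sum_def by (rule dirichlet_character_periodic[OF assms(4)[OF that]])
    show "(\<Sum>r\<in>?I. ?c r * zeta_cont d r s) = lucas_L_series P Q d chi s"
      unfolding lucas_L_series_def U
      using L_series_eq[OF s, of "\<lambda>j n. chi j (int n)"] per by simp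
  qed
  have Z: "generically_equal (d - 1) (cspace (d - 1)) (lucas_zeta P Q q (d - 1) r) (zeta_cont (d - 1) r)"
    if r: "r \<in> ?I" for r
  proof (cases "d - 1 = 0")
    \<comment> \<open>In depth 0 there is a single empty index tuple and its term is an empty
      product, so \<open>zeta_cont\<close> is 1, matching the convention for
      \<open>lucas_zeta\<close>.\<close>
    case True
    then show ?thesis
      by (intro generically_equal_eqI) (simp_all add: lucas_zeta_def zeta_cont_def zeta_term_def)
  next
    case False
    have r': "r i \<ge> 1" if "i \<in> {1..d - 1}" for i using r1[OF r, of i] that by auto
    \<comment> \<open>A single function is presented as a combination over a singleton to fit the
      general statement.\<close>
    have "mv_meromorphic (d - 1) (\<lambda>s. \<Sum>r\<in>{r}. 1 * zeta_cont (d - 1) r s)"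
      by (rule mv_meromorphic_zeta_cont) (use r' in auto)
    then have mer: "mv_meromorphic (d - 1) (zeta_cont (d - 1) r)" by simp
    have "zeta_cont (d - 1) r s = lucas_zeta_series P Q q (d - 1) r s" if "s \<in> convergence_domain (d - 1)" for s
      unfolding lucas_zeta_series_def U index_sum_def[symmetric]
      by (rule zeta_series_eq[OF that r', symmetric])
    then have "generically_equal (d - 1) (cspace (d - 1))
        (meromorphic_continuation (d - 1) (convergence_domain (d - 1)) (lucas_zeta_series P Q q (d - 1) r))
        (zeta_cont (d - 1) r)"
      by (intro meromorphic_continuation_generically_equal[OF openin_convergence_domain nonempty mer])
    then show ?thesis using False by (simp add: lucas_zeta_def)
  qed
  have const: "complex_of_real (lucas_D P Q) powr (a / 2) * ((- a) gchoose k)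
       * ((- 1) ^ k / (of_nat q * complex_of_real (ln (lucas_alpha P Q))))
       * zeta_root q powi (- n * int S) = coef k a * base a k ^ S / (of_nat q * of_real lam)" for S
  proof -
    have "complex_of_real (lucas_D P Q) powr (a / 2) = exp (a * of_real \<delta> / 2)"
      using facts(1) by (simp add: powr_def Ln_of_real \<delta>_def)
    moreover have "zeta_root q powi (- n * int S) = base a k ^ S"
      unfolding root power_int_mult by simp
    ultimately show ?thesis by (simp add: coef_def lam_def \<alpha>_def mult_ac)
  qed
  show ?thesis
  proof (rule has_hyperplane_residue_zeta_cont[OF pole assms(2) _ L])
    show "generically_equal (d - 1) (cspace (d - 1))
      (\<lambda>s. \<Sum>r\<in>?I. ?c r * lucas_zeta P Q q (d - 1) r s * complex_of_real (lucas_D P Q) powr (a / 2)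
         * ((- a) gchoose k) * ((- 1) ^ k / (of_nat q * complex_of_real (ln (lucas_alpha P Q))))
         * zeta_root q powi (- n * int (\<Sum>i=1..d. r i)))
      (\<lambda>s. \<Sum>r\<in>?I. ?c r * (zeta_cont (d - 1) r s *
         (coef k a * base a k ^ (\<Sum>i=1..d. r i) / (of_nat q * of_real lam))))"
    proof (rule generically_equal_sum[OF _ fin])
      fix r assume "r \<in> ?I"
      from generically_equal_compose[OF Z[OF this],
          of "\<lambda>_ z. ?c r * (z * (coef k a * base a k ^ (\<Sum>i=1..d. r i) / (of_nat q * of_real lam)))"]
      show "generically_equal (d - 1) (cspace (d - 1))
        (\<lambda>s. ?c r * lucas_zeta P Q q (d - 1) r s * complex_of_real (lucas_D P Q) powr (a / 2)
         * ((- a) gchoose k) * ((- 1) ^ k / (of_nat q * complex_of_real (ln (lucas_alpha P Q))))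
         * zeta_root q powi (- n * int (\<Sum>i=1..d. r i)))
        (\<lambda>s. ?c r * (zeta_cont (d - 1) r s *
         (coef k a * base a k ^ (\<Sum>i=1..d. r i) / (of_nat q * of_real lam))))"
        by (simp only: const[symmetric] mult.assoc)
    qed simp
  qed (rule r1)
qed

end
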